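(* Let $P$ be a set of $n$ points $p_1,\dots,p_n\in\mathbb{R}^d$, let $\ell$ be a positive integer smaller than $n$, and let $\epsilon\in(0,1/2)$. Then: (i) There is a conservative randomized algorithm for the $\ell$-center clustering problem for $P$ in the Euclidean space $\mathbb{R}^d$ that runs in time $O(n\log n\,(d+\ell)/\epsilon^2)$ and w.h.p. returns a $(2+\epsilon)$-approximate solution, i.e., a set $T\subseteq P$ of $\ell$ centers with $\max_{v\in P}\min_{u\in T}\|v-u\|_2\le (2+\epsilon)\cdot\mathrm{OPT}_{\mathrm{center}}$. (ii) A slight modification of this algorithm runs in the same asymptotic time $O(n\log n\,(d+\ell)/\epsilon^2)$ and w.h.p. returns a partition of $P$ into $\ell$ clusters whose maximum cluster diameter is at most $(2+\epsilon)\cdot\mathrm{OPT}_{\mathrm{diam}}$.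
   Context: $\|\cdot\|_2$ is the Euclidean norm. The $\ell$-center clustering problem in $\mathbb{R}^d$: given a finite set $P\subset\mathbb{R}^d$, find a set $T$ of $\ell$ points of $\mathbb{R}^d$ (centers) minimizing $\max_{v\in P}\min_{u\in T}\|v-u\|_2$; the minimum value is $\mathrm{OPT}_{\mathrm{center}}$. The minimum-diameter $\ell$-clustering problem: find a partition of $P$ into $\ell$ subsets $P_1,\dots,P_\ell$ minimizing $\max_{i}\max_{u,v\in P_i}\|u-v\|_2$; the minimum value is $\mathrm{OPT}_{\mathrm{diam}}$. An algorithm for the $\ell$-center problem is conservative if it always returns centers belonging to the input point set. An event holds with high probability (w.h.p.) if it holds with probability at least $1-1/n^{\beta}$, where $\beta\ge 1$ is any desired constant (the constants in the algorithm may depend on $\beta$). Running times are in the real RAM model with unit-cost arithmetic and access to random bits. *)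

theory Defs
  imports "HOL-Probability.Probability" "HOL-Analysis.Abstract_Euclidean_Space"
begin

section \<open>A real RAM with random bits\<close>

text \<open>
  The machine has memory cells holding natural numbers (used for counting and indirect
  addressing) and memory cells holding exact real numbers. Programs are structured and are
  finite objects that do not depend on the input. Both memories are split into segments: a cell
  is addressed by a segment number, which is fixed in the program text, and an offset, which is
  computed. Since a program mentions finitely many segments, interleaving them gives a linear
  memory with constant overhead.

  There is no rounding operation from reals to naturals, no division of naturals, and no real
  constant in programs other than those obtained from natural numbers; this rules out the usual
  ways of abusing unit-cost arithmetic. Subtraction of naturals is truncated. Real division is
  total, with value 0 for divisor 0.
\<close>

datatype nexp =
    NConst nat
  | NLoad nat nexp
  | NAdd nexp nexp
  | NSub nexp nexp
  | NMult nexp nexp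

datatype rexp =
    ROfNat nexp
  | RLoad nat nexp
  | RAdd rexp rexp
  | RSub rexp rexp
  | RMult rexp rexp
  | RDiv rexp rexp

datatype bexp =
    NLess nexp nexp
  | RLess rexp rexp
  | BNot bexp
  | BAnd bexp bexp

datatype com =
    Skip
  | NStore nat nexp nexp
  | RStore nat nexp rexp
  | Flip nat nexp
  | Seq com com
  | If bexp com com
  | While bexp com

text \<open>The component \<open>coins\<close> is the infinite tape of the random bits that are still unread.\<close>

record state =
  nmem :: "nat \<Rightarrow> nat \<Rightarrow> nat"
  rmem :: "nat \<Rightarrow> nat \<Rightarrow> real"
  coins :: "nat \<Rightarrow> bool"

fun nval :: "nexp \<Rightarrow> state \<Rightarrow> nat" where
  "nval (NConst k) s = k"
| "nval (NLoad g e) s = nmem s g (nval e s)"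
| "nval (NAdd a b) s = nval a s + nval b s"
| "nval (NSub a b) s = nval a s - nval b s"
| "nval (NMult a b) s = nval a s * nval b s"

fun rval :: "rexp \<Rightarrow> state \<Rightarrow> real" where
  "rval (ROfNat e) s = real (nval e s)"
| "rval (RLoad g e) s = rmem s g (nval e s)"
| "rval (RAdd a b) s = rval a s + rval b s"
| "rval (RSub a b) s = rval a s - rval b s"
| "rval (RMult a b) s = rval a s * rval b s"
| "rval (RDiv a b) s = rval a s / rval b s"

fun bval :: "bexp \<Rightarrow> state \<Rightarrow> bool" where
  "bval (NLess a b) s \<longleftrightarrow> nval a s < nval b s"
| "bval (RLess a b) s \<longleftrightarrow> rval a s < rval b s"
| "bval (BNot b) s \<longleftrightarrow> \<not> bval b s"
| "bval (BAnd a b) s \<longleftrightarrow> bval a s \<and> bval b s"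

text \<open>Every operation, memory access and constant in an expression costs one unit.\<close>

fun ncost :: "nexp \<Rightarrow> nat" where
  "ncost (NConst k) = 1"
| "ncost (NLoad g e) = 1 + ncost e"
| "ncost (NAdd a b) = 1 + ncost a + ncost b"
| "ncost (NSub a b) = 1 + ncost a + ncost b"
| "ncost (NMult a b) = 1 + ncost a + ncost b"

fun rcost :: "rexp \<Rightarrow> nat" where
  "rcost (ROfNat e) = 1 + ncost e"
| "rcost (RLoad g e) = 1 + ncost e"
| "rcost (RAdd a b) = 1 + rcost a + rcost b"
| "rcost (RSub a b) = 1 + rcost a + rcost b"
| "rcost (RMult a b) = 1 + rcost a + rcost b"
| "rcost (RDiv a b) = 1 + rcost a + rcost b"

fun bcost :: "bexp \<Rightarrow> nat" where
  "bcost (NLess a b) = 1 + ncost a + ncost b"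
| "bcost (RLess a b) = 1 + rcost a + rcost b"
| "bcost (BNot b) = 1 + bcost b"
| "bcost (BAnd a b) = 1 + bcost a + bcost b"

text \<open>\<open>exec c s t s'\<close>: started in \<open>s\<close>, program \<open>c\<close> halts after \<open>t\<close> time units in \<open>s'\<close>.\<close>

inductive exec :: "com \<Rightarrow> state \<Rightarrow> nat \<Rightarrow> state \<Rightarrow> bool" where
  Skip: "exec Skip s 1 s"
| NStore: "exec (NStore g a e) s (1 + ncost a + ncost e)
    (s\<lparr>nmem := (nmem s)(g := (nmem s g)(nval a s := nval e s))\<rparr>)"
| RStore: "exec (RStore g a e) s (1 + ncost a + rcost e)
    (s\<lparr>rmem := (rmem s)(g := (rmem s g)(nval a s := rval e s))\<rparr>)"
| Flip: "exec (Flip g a) s (1 + ncost a)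
    (s\<lparr>nmem := (nmem s)(g := (nmem s g)(nval a s := of_bool (coins s 0))),
       coins := (\<lambda>i. coins s (Suc i))\<rparr>)"
| Seq: "exec c1 s t1 s' \<Longrightarrow> exec c2 s' t2 s'' \<Longrightarrow> exec (Seq c1 c2) s (t1 + t2) s''"
| IfTrue: "bval b s \<Longrightarrow> exec c1 s t s' \<Longrightarrow> exec (If b c1 c2) s (1 + bcost b + t) s'"
| IfFalse: "\<not> bval b s \<Longrightarrow> exec c2 s t s' \<Longrightarrow> exec (If b c1 c2) s (1 + bcost b + t) s'"
| WhileFalse: "\<not> bval b s \<Longrightarrow> exec (While b c) s (1 + bcost b) s"
| WhileTrue: "bval b s \<Longrightarrow> exec c s t1 s' \<Longrightarrow> exec (While b c) s' t2 s'' \<Longrightarrow>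
    exec (While b c) s (1 + bcost b + t1 + t2) s''"

inductive_cases exec_SkipE: "exec Skip s t s'"
  and exec_NStoreE: "exec (NStore g a e) s t s'"
  and exec_RStoreE: "exec (RStore g a r) s t s'"
  and exec_FlipE: "exec (Flip g a) s t s'"
  and exec_SeqE: "exec (Seq c1 c2) s t s'"
  and exec_IfE: "exec (If b c1 c2) s t s'"
  and exec_WhileE: "exec (While b c) s t s'"

text \<open>
  For a fixed coin tape a run is unique, so a claim that some run has a property is a claim about
  the run.
\<close>

lemma exec_deterministic:
  "exec c s t s' \<Longrightarrow> exec c s u s'' \<Longrightarrow> t = u \<and> s' = s''"
proof (induction arbitrary: u s'' rule: exec.induct)
  case (Seq c1 s t1 s' c2 t2 r)
  from Seq.prems obtain v1 q v2 where "u = v1 + v2" "exec c1 s v1 q" "exec c2 q v2 s''"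
    by (rule exec_SeqE)
  with Seq.IH show ?case by blast
next
  case (IfTrue b s c1 t s' c2)
  from IfTrue.prems IfTrue.hyps(1) obtain v where "u = 1 + bcost b + v" "exec c1 s v s''"
    by (auto elim: exec_IfE)
  with IfTrue.IH show ?case by blast
next
  case (IfFalse b s c2 t s' c1)
  from IfFalse.prems IfFalse.hyps(1) obtain v where "u = 1 + bcost b + v" "exec c2 s v s''"
    by (auto elim: exec_IfE)
  with IfFalse.IH show ?case by blast
next
  case (WhileFalse b s c)
  from WhileFalse.prems show ?case
    by (rule exec_WhileE) (use WhileFalse.hyps in simp_all)
next
  case (WhileTrue b s c t1 s' t2 r)
  from WhileTrue.prems obtain v1 q v2
    where "u = 1 + bcost b + v1 + v2" "exec c s v1 q" "exec (While b c) q v2 s''"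
    by (rule exec_WhileE) (use WhileTrue.hyps(1) in simp_all)
  with WhileTrue.IH show ?case by blast
qed (erule exec_SkipE exec_NStoreE exec_RStoreE exec_FlipE; simp)+

definition coin_tapes :: "(nat \<Rightarrow> bool) measure" where
  "coin_tapes = PiM UNIV (\<lambda>_. measure_pmf (bernoulli_pmf (1/2)))"


section \<open>Clustering in Euclidean space\<close>

text \<open>
  The dimension is an input of the algorithms, so it cannot be a type. Points of
  \<open>d\<close>-dimensional space are the elements of \<open>topspace (Euclidean_space d)\<close>, i.e. sequences
  that vanish from index \<open>d\<close> on.
\<close>

definition edist :: "nat \<Rightarrow> (nat \<Rightarrow> real) \<Rightarrow> (nat \<Rightarrow> real) \<Rightarrow> real" where
  "edist d x y = L2_set (\<lambda>i. x i - y i) {..<d}"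

definition center_cost :: "nat \<Rightarrow> (nat \<Rightarrow> real) set \<Rightarrow> (nat \<Rightarrow> real) set \<Rightarrow> real" where
  "center_cost d P T = Max ((\<lambda>v. Min ((\<lambda>u. edist d v u) ` T)) ` P)"

text \<open>The infimum is attained, by compactness; centers need not belong to \<open>P\<close>.\<close>

definition opt_center :: "nat \<Rightarrow> (nat \<Rightarrow> real) set \<Rightarrow> nat \<Rightarrow> real" where
  "opt_center d P l =
    Inf {center_cost d P T | T. T \<subseteq> topspace (Euclidean_space d) \<and> finite T \<and> card T = l}"

definition diam_cost :: "nat \<Rightarrow> (nat \<Rightarrow> real) set set \<Rightarrow> real" where
  "diam_cost d Q = Max ((\<lambda>A. Max ((\<lambda>(u, v). edist d u v) ` (A \<times> A))) ` Q)"

definition opt_diam :: "nat \<Rightarrow> (nat \<Rightarrow> real) set \<Rightarrow> nat \<Rightarrow> real" where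
  "opt_diam d P l = Min {diam_cost d Q | Q. partition_on P Q \<and> card Q = l}"


section \<open>Input and output conventions\<close>

text \<open>
  The numbers \<open>n\<close>, \<open>d\<close>, \<open>l\<close> and \<open>\<epsilon>\<close> are in segment 0 of the two memories; real segment 1 holds
  the coordinates of the points, point by point. All other cells are 0.
\<close>

definition input ::
  "nat \<Rightarrow> nat \<Rightarrow> nat \<Rightarrow> real \<Rightarrow> (nat \<Rightarrow> nat \<Rightarrow> real) \<Rightarrow> (nat \<Rightarrow> bool) \<Rightarrow> state" where
  "input n d l \<epsilon> p \<omega> = \<lparr>
     nmem = (\<lambda>g a. if g = 0 \<and> a = 0 then n else if g = 0 \<and> a = 1 then d
                    else if g = 0 \<and> a = 2 then l else 0),
     rmem = (\<lambda>g a. if g = 0 \<and> a = 0 then \<epsilon>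
                    else if g = 1 \<and> a < n * d then p (a div d) (a mod d) else 0),
     coins = \<omega>\<rparr>"

text \<open>Centers are returned by their coordinates, in real segment 2.\<close>

definition output_centers :: "nat \<Rightarrow> nat \<Rightarrow> state \<Rightarrow> (nat \<Rightarrow> real) set" where
  "output_centers d l s =
    (\<lambda>j i. if i < d then rmem s 2 (j * d + i) else 0) ` {..<l}"

text \<open>
  A clustering is returned by cluster labels \<open>0, \<dots>, l - 1\<close> of the points, in segment 1 of the
  memory for natural numbers.
\<close>

definition output_clusters ::
  "nat \<Rightarrow> nat \<Rightarrow> (nat \<Rightarrow> nat \<Rightarrow> real) \<Rightarrow> state \<Rightarrow> (nat \<Rightarrow> real) set set" where
  "output_clusters n l p s = (\<lambda>k. {p j | j. j < n \<and> nmem s 1 j = k}) ` {..<l}"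

definition clustering_instance ::
  "nat \<Rightarrow> nat \<Rightarrow> nat \<Rightarrow> real \<Rightarrow> (nat \<Rightarrow> nat \<Rightarrow> real) \<Rightarrow> bool" where
  "clustering_instance n d l \<epsilon> p \<longleftrightarrow>
    0 < l \<and> l < n \<and> 0 < \<epsilon> \<and> \<epsilon> < 1/2 \<and>
    p ` {..<n} \<subseteq> topspace (Euclidean_space d) \<and> inj_on p {..<n}"

text \<open>
  The running time bound, like the requirement that the output has the right form, is for every
  coin tape.
\<close>

definition runs_in_time :: "com \<Rightarrow> state \<Rightarrow> real \<Rightarrow> (state \<Rightarrow> bool) \<Rightarrow> bool" where
  "runs_in_time prog s T good \<longleftrightarrow> (\<exists>t s'. exec prog s t s' \<and> real t \<le> T \<and> good s')"

definition success_prob :: "com \<Rightarrow> ((nat \<Rightarrow> bool) \<Rightarrow> state) \<Rightarrow> (state \<Rightarrow> bool) \<Rightarrow> real" where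
  "success_prob prog inp good =
    \<P>(\<omega> in coin_tapes. \<exists>t s'. exec prog (inp \<omega>) t s' \<and> good s')"

end

theory Submission
  imports Defs
begin

text \<open>
  Project the points by a \<open>k \<times> d\<close> matrix of random signs with \<open>k = O(log n / \<epsilon>\<^sup>2)\<close>
  (Johnson--Lindenstrauss) and run Gonzalez' farthest-first traversal on the projections. If the
  traversal stops with sketched radius \<open>R\<close>, then the \<open>l\<close> centers and the farthest point are
  \<open>l + 1\<close> input points with pairwise sketched distances at least \<open>R\<close>. By pigeonhole two of them
  share an optimal cluster, so \<open>R\<close> bounds both optima from below. Only distances between input points
  enter, although the optimal centers need not be input points, so it suffices that the projection
  preserves these \<open>n\<^sup>2\<close> distances. The same program solves both problems.
\<close>

section \<open>Random signs\<close>

text \<open>Signs suit a machine whose only randomness is fair bits: one toss gives one matrix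
  entry. All tapes share one time bound, so a run reads a bounded prefix of its tape, and
  probabilities can be computed with \<open>coin_avg\<close>, the average over the first
  \<open>N\<close> tosses of a tape continued by \<open>False\<close>. Its recursion peels tapes
  from the front, as the product measure is peeled in \<open>prefix_event\<close>. The machine has
  no square root, so the traversal compares squared sketched distances. These may violate the
  triangle inequality; therefore the traversal is analysed for a symmetric nonnegative
  \<open>\<delta>\<close>, and triangle inequalities are applied to true distances only, after
  translating back. Distorting squared distances by \<open>\<epsilon> / 4\<close> costs at most a
  factor \<open>1 + \<epsilon> / 2\<close> on distances, and twice that is
  \<open>2 + \<epsilon>\<close>. Putting \<open>\<eta> = \<epsilon> / 4\<close> into the tail
  exponent \<open>k * \<eta>^2 / 512\<close> gives \<open>k * \<epsilon>^2 / 8192\<close>, the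
  origin of the factor 8192 in \<open>B\<close>. Chance affects quality alone: the traversal
  invariant holds for any sketch, so output form and running time are guaranteed on every
  tape.\<close>

fun coin_avg :: "nat \<Rightarrow> ((nat \<Rightarrow> bool) \<Rightarrow> real) \<Rightarrow> real" where
  "coin_avg 0 f = f (\<lambda>_. False)"
| "coin_avg (Suc N) f =
    (coin_avg N (\<lambda>\<omega>. f (case_nat True \<omega>)) + coin_avg N (\<lambda>\<omega>. f (case_nat False \<omega>))) / 2"

lemma coin_avg_const [simp]: "coin_avg N (\<lambda>_. c) = c"
  by (induction N) auto

lemma coin_avg_mono: "(\<And>\<omega>. f \<omega> \<le> g \<omega>) \<Longrightarrow> coin_avg N f \<le> coin_avg N g"
  by (induction N arbitrary: f g) (auto intro!: add_mono divide_right_mono)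

lemma coin_avg_add: "coin_avg N (\<lambda>\<omega>. f \<omega> + g \<omega>) = coin_avg N f + coin_avg N g"
  by (induction N arbitrary: f g) (auto simp: add_divide_distrib)

lemma coin_avg_cmult: "coin_avg N (\<lambda>\<omega>. c * f \<omega>) = c * coin_avg N f"
  by (induction N arbitrary: f) (auto simp: algebra_simps add_divide_distrib)

lemma coin_avg_mult_right: "coin_avg N (\<lambda>\<omega>. f \<omega> * c) = coin_avg N f * c"
  using coin_avg_cmult[of N c f] by (simp add: mult.commute)

lemma coin_avg_sum: "coin_avg N (\<lambda>\<omega>. \<Sum>i\<in>I. f i \<omega>) = (\<Sum>i\<in>I. coin_avg N (f i))"
  by (induction I rule: infinite_finite_induct) (auto simp: coin_avg_add)

text \<open>Independence of consecutive blocks of tosses, written as an iterated average. Peeling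
  off the first toss commutes with concatenation and only moves the boundary \<open>N\<close> by
  one.\<close>

lemma coin_avg_append:
  "coin_avg (N + M) f =
    coin_avg N (\<lambda>a. coin_avg M (\<lambda>b. f (\<lambda>i. if i < N then a i else b (i - N))))"
proof (induction N arbitrary: f)
  case (Suc N)
  have "case_nat x (\<lambda>i. if i < N then a i else b (i - N)) =
      (\<lambda>i. if i < Suc N then case_nat x a i else b (i - Suc N))" for x :: bool and a b
    by (rule ext) (auto split: nat.split)
  with Suc show ?case by simp
qed simp

definition sgn_of :: "bool \<Rightarrow> real" where
  "sgn_of b = (if b then 1 else -1)"

definition rademacher :: "nat \<Rightarrow> (nat \<Rightarrow> real) \<Rightarrow> (nat \<Rightarrow> bool) \<Rightarrow> real" where
  "rademacher d x \<omega> = (\<Sum>i<d. sgn_of (\<omega> i) * x i)"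

lemma rademacher_Suc:
  "rademacher (Suc d) x (case_nat b \<omega>) = sgn_of b * x 0 + rademacher d (\<lambda>i. x (Suc i)) \<omega>"
  unfolding rademacher_def by (simp only: sum.lessThan_Suc_shift) simp

text \<open>The rows read disjoint blocks of \<open>d\<close> tosses, so the average of the product
  factors; the factors agree because every row is applied to the same \<open>x\<close>.\<close>

lemma coin_avg_blocks:
  "coin_avg (k * d) (\<lambda>\<omega>. \<Prod>r<k. h (rademacher d x (\<lambda>i. \<omega> (r * d + i)))) =
    coin_avg d (\<lambda>\<omega>. h (rademacher d x \<omega>)) ^ k"
proof (induction k)
  case (Suc k)
  \<comment> \<open>The unsimplified \<open>0 * d\<close> is the shape that splitting off the factor
    for \<open>r = 0\<close> leaves behind.\<close>
  have first: "rademacher d x (\<lambda>i. if 0 * d + i < d then a (0 * d + i) else b (0 * d + i - d)) =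
      rademacher d x a" for a b
    by (auto simp: rademacher_def intro!: sum.cong)
  have rest: "(\<lambda>i. if Suc r * d + i < d then a (Suc r * d + i) else b (Suc r * d + i - d)) =
      (\<lambda>i. b (r * d + i))" for a b :: "nat \<Rightarrow> bool" and r
    by (auto simp: fun_eq_iff)
  have "coin_avg (Suc k * d) (\<lambda>\<omega>. \<Prod>r<Suc k. h (rademacher d x (\<lambda>i. \<omega> (r * d + i)))) =
      coin_avg d (\<lambda>a. coin_avg (k * d) (\<lambda>b. h (rademacher d x a) *
        (\<Prod>r<k. h (rademacher d x (\<lambda>i. b (r * d + i))))))"
    unfolding mult_Suc coin_avg_append prod.lessThan_Suc_shift first rest[unfolded mult_Suc] 
    using first by simp
  also have "\<dots> = coin_avg d (\<lambda>\<omega>. h (rademacher d x \<omega>)) ^ Suc k"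
    unfolding coin_avg_cmult Suc.IH by (simp add: coin_avg_mult_right)
  finally show ?case .
qed simp

text \<open>The offset \<open>s\<close> collects the signed coordinates already revealed, which
  makes the induction close; the cross terms of the two values of a sign cancel.\<close>

lemma coin_avg_rademacher_square:
  "coin_avg d (\<lambda>\<omega>. (s + rademacher d x \<omega>)\<^sup>2) = s\<^sup>2 + (\<Sum>i<d. (x i)\<^sup>2)"
proof (induction d arbitrary: s x)
  case (Suc d)
  show ?case
    unfolding coin_avg.simps rademacher_Suc add.assoc[symmetric] Suc.IH sum.lessThan_Suc_shift
    by (simp add: sgn_of_def power2_eq_square algebra_simps)
qed (simp add: rademacher_def)

text \<open>Sub-Gaussianity of one fair sign. It is the inequality behind Hoeffding's lemma at
  probability 1/2 and width \<open>2 * z\<close>, after factoring out \<open>exp z\<close>; evenness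
  of \<open>cosh\<close> covers negative arguments.\<close>

lemma cosh_le_exp_square: "cosh (y::real) \<le> exp (y\<^sup>2 / 2)"
proof -
  have pos: "cosh z \<le> exp (z\<^sup>2 / 2)" if "0 \<le> z" for z :: real
  proof -
    have "- (2 * z) * (1/2) + ln (1 + (1/2) * (exp (2 * z) - 1)) \<le> (2 * z)\<^sup>2 / 8"
      by (rule Hoeffdings_lemma_aux) (use that in auto)
    also have "1 + (1/2) * (exp (2 * z) - 1) = exp z * cosh z"
      by (simp add: cosh_def field_simps flip: exp_add)
    also have "ln (exp z * cosh z) = z + ln (cosh z)"
      by (simp add: ln_mult)
    finally have "ln (cosh z) \<le> z\<^sup>2 / 2"
      by simp
    then show ?thesis
      by (metis cosh_real_pos exp_le_cancel_iff exp_ln)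
  qed
  show ?thesis
    using pos[of "\<bar>y\<bar>"] by (simp add: cosh_real_abs)
qed

text \<open>
  Revealing the signs one at a time turns \<open>exp (a s\<^sup>2)\<close> into \<open>exp (a' s\<^sup>2 + a' x\<^sup>2)\<close> with
  \<open>1 / a' = 1 / a - 2 x\<^sup>2\<close>, because \<open>cosh y \<le> exp (y\<^sup>2 / 2)\<close>.
\<close>

lemma coin_avg_exp_square:
  assumes "0 \<le> a" and "2 * a * (\<Sum>i<d. (x i)\<^sup>2) < 1"
  shows "coin_avg d (\<lambda>\<omega>. exp (a * (s + rademacher d x \<omega>)\<^sup>2)) \<le>
    exp (a / (1 - 2 * a * (\<Sum>i<d. (x i)\<^sup>2)) * (s\<^sup>2 + (\<Sum>i<d. (x i)\<^sup>2)))"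
  using assms(2)
proof (induction d arbitrary: s x)
  case (Suc d)
  define W where "W = (\<Sum>i<d. (x (Suc i))\<^sup>2)"
  define y where "y = x 0"
  define A where "A = a / (1 - 2 * a * W)"
  define A' where "A' = a / (1 - 2 * a * (y\<^sup>2 + W))"
  have sum: "(\<Sum>i<Suc d. (x i)\<^sup>2) = y\<^sup>2 + W"
    unfolding sum.lessThan_Suc_shift by (simp add: W_def y_def)
  have W0: "0 \<le> W" by (simp add: W_def sum_nonneg)
  have lt: "2 * a * (y\<^sup>2 + W) < 1" using Suc.prems by (simp only: sum)
  have "2 * a * W \<le> 2 * a * (y\<^sup>2 + W)" using assms(1) by (intro mult_left_mono) auto
  then have ltW: "2 * a * W < 1" using lt by simp
  have A0: "0 \<le> A" using assms(1) ltW by (simp add: A_def)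
  \<comment> \<open>In the variables \<open>u\<close> and \<open>v\<close> below, this is
    \<open>(u + v) * (u - v) \<le> u^2\<close> after division.\<close>
  have A_step: "A * (1 + 2 * A * y\<^sup>2) \<le> A'"
  proof -
    define u where "u = 1 - 2 * a * W"
    define v where "v = 2 * a * y\<^sup>2"
    have u: "0 < u" and v: "0 \<le> v" "v < u"
      using ltW lt assms(1) by (auto simp: u_def v_def algebra_simps)
    have "(u + v) / u\<^sup>2 \<le> 1 / (u - v)"
      using u v by (simp add: divide_simps) (simp add: power2_eq_square algebra_simps)
    then have "a * ((u + v) / u\<^sup>2) \<le> a * (1 / (u - v))"
      by (rule mult_left_mono) (rule assms(1))
    moreover have "A * (1 + 2 * A * y\<^sup>2) = a * ((u + v) / u\<^sup>2)"
    proof -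
      have "a = A * u" using u by (simp add: A_def u_def)
      then show ?thesis using u by (simp add: v_def field_simps power2_eq_square)
    qed
    moreover have "A' = a * (1 / (u - v))"
      by (simp add: A'_def u_def v_def algebra_simps)
    ultimately show ?thesis by simp
  qed
  have IH: "coin_avg d (\<lambda>\<omega>. exp (a * (s + sgn_of b * y + rademacher d (\<lambda>i. x (Suc i)) \<omega>)\<^sup>2))
      \<le> exp (A * ((s + sgn_of b * y)\<^sup>2 + W))" for b
    using Suc.IH[of "\<lambda>i. x (Suc i)"] ltW by (simp add: W_def A_def)
  have "coin_avg (Suc d) (\<lambda>\<omega>. exp (a * (s + rademacher (Suc d) x \<omega>)\<^sup>2)) \<le>
      (exp (A * ((s + y)\<^sup>2 + W)) + exp (A * ((s - y)\<^sup>2 + W))) / 2"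
  proof -
    have eq: "s + rademacher (Suc d) x (case_nat b \<omega>) =
        s + sgn_of b * y + rademacher d (\<lambda>i. x (Suc i)) \<omega>" for b \<omega>
      by (simp add: rademacher_Suc y_def)
    show ?thesis
      unfolding coin_avg.simps eq using IH[of True] IH[of False] by (simp add: sgn_of_def)
  qed
  also have "\<dots> = exp (A * (s\<^sup>2 + y\<^sup>2 + W)) * cosh (2 * A * s * y)"
  proof -
    have "A * ((s + y)\<^sup>2 + W) = A * (s\<^sup>2 + y\<^sup>2 + W) + 2 * A * s * y"
      "A * ((s - y)\<^sup>2 + W) = A * (s\<^sup>2 + y\<^sup>2 + W) + - (2 * A * s * y)"
      by (simp_all add: power2_eq_square algebra_simps)
    then show ?thesis
      by (simp only: exp_add cosh_def) (simp add: algebra_simps)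
  qed
  \<comment> \<open>The cross term \<open>2 * A * s * y\<close> becomes
    \<open>2 * A^2 * s^2 * y^2\<close>, which raises the coefficient of \<open>s^2\<close> from
    \<open>A\<close> to the left side of \<open>A_step\<close>.\<close>
  also have "\<dots> \<le> exp (A * (s\<^sup>2 + y\<^sup>2 + W)) * exp ((2 * A * s * y)\<^sup>2 / 2)"
    by (intro mult_left_mono cosh_le_exp_square) simp
  also have "\<dots> = exp (A * (1 + 2 * A * y\<^sup>2) * s\<^sup>2 + A * (y\<^sup>2 + W))"
    by (simp add: power2_eq_square algebra_simps flip: exp_add)
  also have "\<dots> \<le> exp (A' * s\<^sup>2 + A' * (y\<^sup>2 + W))"
  proof -
    have "A * 1 \<le> A * (1 + 2 * A * y\<^sup>2)"
      using A0 by (intro mult_left_mono) auto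
    with A_step have "A \<le> A'" by linarith
    then show ?thesis
      using A_step W0 by (auto intro!: add_mono mult_right_mono)
  qed
  finally show ?case
    by (simp only: sum A'_def distrib_left)
qed (simp add: rademacher_def)

text \<open>A second-order expansion at \<open>t = 0\<close>, valid for both signs of
  \<open>t\<close> and hence usable for both tails. The linear term averages exactly to
  \<open>t\<close>; the remainder is controlled by the exponential moment at \<open>1/4\<close>,
  which is at most \<open>exp (1/2)\<close> and so at most 2.\<close>

lemma coin_avg_exp_square_unit:
  assumes norm: "(\<Sum>i<d. (x i)\<^sup>2) = 1" and t: "\<bar>t\<bar> \<le> 1/8"
  shows "coin_avg d (\<lambda>\<omega>. exp (t * (rademacher d x \<omega>)\<^sup>2)) \<le> exp (t + 128 * t\<^sup>2)"
proof -
  have pointwise: "exp (t * q) \<le> 1 + t * q + 64 * t\<^sup>2 * exp (q / 4)" if q: "0 \<le> q" for q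
  proof -
    obtain z where z: "\<bar>z\<bar> \<le> \<bar>t * q\<bar>"
      and eq: "exp (t * q) = (\<Sum>m<2. (t * q) ^ m / fact m) + exp z / fact 2 * (t * q) ^ 2"
      using Maclaurin_exp_le[of "t * q" 2] by blast
    have "\<bar>t * q\<bar> \<le> (1/8) * q" unfolding abs_mult using t q by (intro mult_mono) auto
    then have "z \<le> q / 8" using z by simp
    then have "exp z / 2 * (t * q)\<^sup>2 \<le> exp (q / 8) / 2 * (t * q)\<^sup>2"
      by (intro mult_right_mono divide_right_mono) auto
    \<comment> \<open>Rescaling \<open>q\<close> to \<open>q / 8\<close> produces
      \<open>64 = 8^2\<close> and lets a second \<open>exp (q / 8)\<close> absorb the quadratic
      factor. The two exponentials combine to \<open>exp (q / 4)\<close>, whose average is under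
      control.\<close>
    also have "\<dots> = 64 * t\<^sup>2 * (exp (q / 8) * ((q / 8)\<^sup>2 / 2))"
      by (simp add: power2_eq_square)
    also have "\<dots> \<le> 64 * t\<^sup>2 * (exp (q / 8) * exp (q / 8))"
      using exp_lower_Taylor_quadratic[of "q / 8"] q by (intro mult_left_mono) auto
    also have "\<dots> = 64 * t\<^sup>2 * exp (q / 4)"
      by (simp flip: exp_add)
    finally show ?thesis
      using eq by (simp add: numeral_2_eq_2)
  qed
  have "coin_avg d (\<lambda>\<omega>. exp (t * (rademacher d x \<omega>)\<^sup>2)) \<le>
      coin_avg d (\<lambda>\<omega>. 1 + t * (rademacher d x \<omega>)\<^sup>2 + 64 * t\<^sup>2 * exp (1/4 * (rademacher d x \<omega>)\<^sup>2))"
    by (intro coin_avg_mono) (use pointwise in simp)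
  also have "\<dots> = 1 + t + 64 * t\<^sup>2 * coin_avg d (\<lambda>\<omega>. exp (1/4 * (rademacher d x \<omega>)\<^sup>2))"
    using coin_avg_rademacher_square[of d 0 x] norm
    by (simp only: coin_avg_add coin_avg_cmult coin_avg_const) simp
  also have "\<dots> \<le> 1 + t + 64 * t\<^sup>2 * 2"
  proof -
    have "coin_avg d (\<lambda>\<omega>. exp (1/4 * (rademacher d x \<omega>)\<^sup>2)) \<le> exp (1/2)"
      using coin_avg_exp_square[of "1/4" x d 0] norm by simp
    also have "\<dots> \<le> (2::real)"
      using exp_bound_half[of "1/2::real"] by simp
    finally show ?thesis by (intro add_left_mono mult_left_mono) auto
  qed
  also have "\<dots> \<le> exp (t + 128 * t\<^sup>2)"
    using exp_ge_add_one_self[of "t + 128 * t\<^sup>2"] by linarith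
  finally show ?thesis .
qed

text \<open>Squared length of the sketch, left unnormalised: its mean is \<open>k\<close> times the
  squared norm of \<open>x\<close>. A common factor changes no comparison made by the
  traversal.\<close>

definition sketch_sq :: "nat \<Rightarrow> nat \<Rightarrow> (nat \<Rightarrow> real) \<Rightarrow> (nat \<Rightarrow> bool) \<Rightarrow> real" where
  "sketch_sq k d x \<omega> = (\<Sum>r<k. (rademacher d x (\<lambda>i. \<omega> (r * d + i)))\<^sup>2)"

lemma coin_avg_exp_sketch_sq:
  assumes "(\<Sum>i<d. (x i)\<^sup>2) = 1" and "\<bar>t\<bar> \<le> 1/8"
  shows "coin_avg (k * d) (\<lambda>\<omega>. exp (t * sketch_sq k d x \<omega>)) \<le> exp (real k * (t + 128 * t\<^sup>2))"
proof -
  have "coin_avg (k * d) (\<lambda>\<omega>. exp (t * sketch_sq k d x \<omega>)) =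
      coin_avg d (\<lambda>\<omega>. exp (t * (rademacher d x \<omega>)\<^sup>2)) ^ k"
    using coin_avg_blocks[of k d "\<lambda>z. exp (t * z\<^sup>2)" x]
    by (simp add: sketch_sq_def sum_distrib_left exp_sum)
  also have "\<dots> \<le> exp (t + 128 * t\<^sup>2) ^ k"
    using coin_avg_mono[of "\<lambda>_. 0" "\<lambda>\<omega>. exp (t * (rademacher d x \<omega>)\<^sup>2)" d]
    by (intro power_mono coin_avg_exp_square_unit assms) simp
  finally show ?thesis by (simp add: exp_of_nat_mult)
qed

text \<open>Chernoff's method. The exponential Markov bounds of both tails are added pointwise,
  before averaging.\<close>

lemma sketch_sq_tail_unit:
  assumes norm: "(\<Sum>i<d. (x i)\<^sup>2) = 1" and \<eta>: "0 \<le> \<eta>" "\<eta> \<le> 1"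
  shows "coin_avg (k * d) (\<lambda>\<omega>. of_bool (\<eta> * k < \<bar>sketch_sq k d x \<omega> - k\<bar>)) \<le>
    2 * exp (- (k * \<eta>\<^sup>2 / 512))"
proof -
  \<comment> \<open>The minimiser of \<open>128 * t^2 - \<eta> * t\<close>, the exponent per row in
    either tail; the minimum is \<open>- \<eta>^2 / 512\<close>.\<close>
  define t where "t = \<eta> / 256"
  have t: "0 \<le> t" "t \<le> 1/8" using \<eta> by (auto simp: t_def)
  let ?Z = "sketch_sq k d x"
  have "of_bool (\<eta> * k < \<bar>?Z \<omega> - k\<bar>) \<le> exp (- (t * (1 + \<eta>) * k)) * exp (t * ?Z \<omega>)
      + exp (t * (1 - \<eta>) * k) * exp (- t * ?Z \<omega>)" for \<omega>
  proof (cases "\<eta> * k < \<bar>?Z \<omega> - k\<bar>")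
    case True
    then consider "0 \<le> ?Z \<omega> - (1 + \<eta>) * k" | "0 \<le> (1 - \<eta>) * k - ?Z \<omega>"
      by (fastforce simp: algebra_simps abs_if split: if_splits)
    then show ?thesis
    proof cases
      case 1
      then have "0 \<le> t * (?Z \<omega> - (1 + \<eta>) * k)" using t by simp
      then have "1 \<le> exp (- (t * (1 + \<eta>) * k)) * exp (t * ?Z \<omega>)"
        by (simp add: algebra_simps flip: exp_add)
      then show ?thesis using True by (smt (verit) exp_gt_zero mult_pos_pos of_bool_eq(2))
    next
      case 2
      then have "0 \<le> t * ((1 - \<eta>) * k - ?Z \<omega>)" using t by simp
      then have "1 \<le> exp (t * (1 - \<eta>) * k) * exp (- t * ?Z \<omega>)"
        by (simp add: algebra_simps flip: exp_add)
      then show ?thesis using True by (smt (verit) exp_gt_zero mult_pos_pos of_bool_eq(2))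
    qed
  qed (simp add: add_nonneg_nonneg)
  then have "coin_avg (k * d) (\<lambda>\<omega>. of_bool (\<eta> * k < \<bar>?Z \<omega> - k\<bar>)) \<le>
      exp (- (t * (1 + \<eta>) * k)) * coin_avg (k * d) (\<lambda>\<omega>. exp (t * ?Z \<omega>)) +
      exp (t * (1 - \<eta>) * k) * coin_avg (k * d) (\<lambda>\<omega>. exp (- t * ?Z \<omega>))"
    unfolding coin_avg_cmult[symmetric] coin_avg_add[symmetric] by (rule coin_avg_mono)
  also have "\<dots> \<le> exp (- (t * (1 + \<eta>) * k)) * exp (k * (t + 128 * t\<^sup>2)) +
      exp (t * (1 - \<eta>) * k) * exp (k * (- t + 128 * (- t)\<^sup>2))"
    using t by (intro add_mono mult_left_mono coin_avg_exp_sketch_sq norm) auto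
  also have "\<dots> = 2 * exp (- (k * \<eta>\<^sup>2 / 512))"
  proof -
    have "- (t * (1 + \<eta>) * k) + k * (t + 128 * t\<^sup>2) = - (k * \<eta>\<^sup>2 / 512)"
      "t * (1 - \<eta>) * k + k * (- t + 128 * (- t)\<^sup>2) = - (k * \<eta>\<^sup>2 / 512)"
      by (simp_all add: t_def field_simps power2_eq_square)
    then show ?thesis by (simp only: exp_add[symmetric])
  qed
  finally show ?thesis .
qed

text \<open>Both sides of the deviation inequality scale quadratically in \<open>x\<close>, which
  reduces to unit vectors. The zero vector, which arises from a point paired with itself, is treated
  separately: there the strict inequality reads \<open>0 < 0\<close>.\<close>

lemma sketch_sq_tail:
  assumes \<eta>: "0 \<le> \<eta>" "\<eta> \<le> 1"
  shows "coin_avg (k * d) (\<lambda>\<omega>. of_bool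
      (\<eta> * k * (\<Sum>i<d. (x i)\<^sup>2) < \<bar>sketch_sq k d x \<omega> - k * (\<Sum>i<d. (x i)\<^sup>2)\<bar>)) \<le>
    2 * exp (- (k * \<eta>\<^sup>2 / 512))"
proof (cases "(\<Sum>i<d. (x i)\<^sup>2) = 0")
  case True
  then have "\<forall>i<d. x i = 0" by (simp add: sum_nonneg_eq_0_iff)
  then have "sketch_sq k d x \<omega> = 0" for \<omega> by (simp add: sketch_sq_def rademacher_def)
  with True show ?thesis by simp
next
  case False
  define c where "c = sqrt (\<Sum>i<d. (x i)\<^sup>2)"
  have c2: "(\<Sum>i<d. (x i)\<^sup>2) = c\<^sup>2" by (simp add: c_def sum_nonneg)
  have c: "0 < c" using False sum_nonneg[of "{..<d}" "\<lambda>i. (x i)\<^sup>2"] by (auto simp: c_def less_le)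
  define y where "y i = x i / c" for i
  have norm: "(\<Sum>i<d. (y i)\<^sup>2) = 1"
    using c by (simp add: y_def power_divide c2 flip: sum_divide_distrib)
  have "rademacher d x \<omega> = c * rademacher d y \<omega>" for \<omega>
    unfolding rademacher_def sum_distrib_left using c by (intro sum.cong) (auto simp: y_def)
  then have "sketch_sq k d x \<omega> = c\<^sup>2 * sketch_sq k d y \<omega>" for \<omega>
    by (simp add: sketch_sq_def power_mult_distrib sum_distrib_left)
  then have "sketch_sq k d x \<omega> - k * c\<^sup>2 = c\<^sup>2 * (sketch_sq k d y \<omega> - k)" for \<omega>
    by (simp add: algebra_simps)
  then have "\<bar>sketch_sq k d x \<omega> - k * c\<^sup>2\<bar> = c\<^sup>2 * \<bar>sketch_sq k d y \<omega> - k\<bar>" for \<omega>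
    by (simp add: abs_mult)
  then have "\<eta> * k * c\<^sup>2 < \<bar>sketch_sq k d x \<omega> - k * c\<^sup>2\<bar> \<longleftrightarrow>
      \<eta> * k < \<bar>sketch_sq k d y \<omega> - k\<bar>" for \<omega>
    using c by (simp add: mult.commute[of _ "c\<^sup>2"])
  then show ?thesis unfolding c2 using sketch_sq_tail_unit[OF norm \<eta>] by simp
qed

section \<open>From finite averages to the measure on coin tapes\<close>

interpretation coins: sequence_space "measure_pmf (bernoulli_pmf (1/2))"
  by standard

lemma space_coin_tapes [simp]: "space coin_tapes = UNIV"
  by (simp add: coin_tapes_def space_PiM)

text \<open>Induction on the prefix length, revealing the first toss. Measurability is a conclusion
  because the events of interest speak about program runs and come with no other reason to be
  measurable.\<close>

lemma prefix_event:
  assumes "\<And>\<omega> \<omega>'. (\<And>i. i < N \<Longrightarrow> \<omega> i = \<omega>' i) \<Longrightarrow> Q \<omega> \<longleftrightarrow> Q \<omega>'"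
  shows "{\<omega>. Q \<omega>} \<in> sets coin_tapes"
    and "measure coin_tapes {\<omega>. Q \<omega>} = coin_avg N (\<lambda>\<omega>. of_bool (Q \<omega>))"
proof -
  have "{\<omega>. Q \<omega>} \<in> sets coin_tapes \<and>
    measure coin_tapes {\<omega>. Q \<omega>} = coin_avg N (\<lambda>\<omega>. of_bool (Q \<omega>))"
    using assms
  proof (induction N arbitrary: Q)
    case 0
    then have "Q \<omega> = Q (\<lambda>_. False)" for \<omega> by blast
    then consider "\<And>\<omega>. Q \<omega>" | "\<And>\<omega>. \<not> Q \<omega>" by blast
    then show ?case
      using sets.top[of coin_tapes] coins.P.prob_space[folded coin_tapes_def]
      by cases simp_all
  next
    case (Suc N)
    let ?B = "measure_pmf (bernoulli_pmf (1/2))"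
    have "{\<omega>. Q (case_nat b \<omega>)} \<in> sets coin_tapes \<and>
        measure coin_tapes {\<omega>. Q (case_nat b \<omega>)} =
        coin_avg N (\<lambda>\<omega>. of_bool (Q (case_nat b \<omega>)))" for b
    proof (rule Suc.IH)
      fix \<omega> \<omega>' :: "nat \<Rightarrow> bool"
      assume eq: "\<And>i. i < N \<Longrightarrow> \<omega> i = \<omega>' i"
      show "Q (case_nat b \<omega>) \<longleftrightarrow> Q (case_nat b \<omega>')"
        by (rule Suc.prems) (auto simp: eq split: nat.split)
    qed
    then have sets_b: "{\<omega>. Q (case_nat b \<omega>)} \<in> sets coin_tapes"
      and meas_b: "measure coin_tapes {\<omega>. Q (case_nat b \<omega>)} =
        coin_avg N (\<lambda>\<omega>. of_bool (Q (case_nat b \<omega>)))" for b by auto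
    have shift: "(\<lambda>\<omega> i. \<omega> (Suc i)) \<in> measurable coin_tapes coin_tapes"
      unfolding coin_tapes_def by (rule measurable_PiM_single') (auto simp: space_PiM)
    have coord: "(\<lambda>\<omega>. \<omega> 0) \<in> measurable coin_tapes (count_space UNIV)"
      unfolding coin_tapes_def
      using measurable_component_singleton[of 0 UNIV "\<lambda>_. ?B"] by simp
    have "{\<omega>. Q \<omega>} = (\<Union>b. ((\<lambda>\<omega>. \<omega> 0) -` {b} \<inter> space coin_tapes) \<inter>
        ((\<lambda>\<omega> i. \<omega> (Suc i)) -` {\<omega>. Q (case_nat b \<omega>)} \<inter> space coin_tapes))"
      (is "_ = ?R")
    proof (rule set_eqI)
      fix \<omega> :: "nat \<Rightarrow> bool"
      have "case_nat (\<omega> 0) (\<lambda>i. \<omega> (Suc i)) = \<omega>"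
        by (auto simp: fun_eq_iff split: nat.split)
      then show "\<omega> \<in> {\<omega>. Q \<omega>} \<longleftrightarrow> \<omega> \<in> ?R" by simp
    qed
    also have "\<dots> \<in> sets coin_tapes"
      by (intro sets.finite_UN sets.Int measurable_sets[OF shift] measurable_sets[OF coord] sets_b)
        auto
    finally have sets: "{\<omega>. Q \<omega>} \<in> sets coin_tapes" .
    have cons: "(\<lambda>(b, \<omega>). case_nat b \<omega>) \<in> measurable (?B \<Otimes>\<^sub>M coin_tapes) coin_tapes"
      unfolding coin_tapes_def by measurable
    \<comment> \<open>A random tape is a fair bit followed by an independent random tape; averaging
      over that bit is the recursion of \<open>coin_avg\<close>.\<close>
    have "emeasure coin_tapes {\<omega>. Q \<omega>} =
        emeasure (distr (?B \<Otimes>\<^sub>M coin_tapes) coin_tapes (\<lambda>(b, \<omega>). case_nat b \<omega>)) {\<omega>. Q \<omega>}"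
      using coins.PiM_iter by (simp add: coin_tapes_def)
    also have "\<dots> = emeasure (?B \<Otimes>\<^sub>M coin_tapes)
        ((\<lambda>(b, \<omega>). case_nat b \<omega>) -` {\<omega>. Q \<omega>} \<inter> space (?B \<Otimes>\<^sub>M coin_tapes))"
      by (rule emeasure_distr[OF cons sets])
    also have "\<dots> = (\<integral>\<^sup>+b. emeasure coin_tapes {\<omega>. Q (case_nat b \<omega>)} \<partial>?B)"
    proof (subst sigma_finite_measure.emeasure_pair_measure_alt)
      show "sigma_finite_measure coin_tapes"
        unfolding coin_tapes_def by standard
    qed (use measurable_sets[OF cons sets] in
        \<open>auto simp: vimage_def space_pair_measure intro!: nn_integral_cong arg_cong2[of _ _ _ _ emeasure]\<close>)
    also have "\<dots> = ennreal (coin_avg (Suc N) (\<lambda>\<omega>. of_bool (Q \<omega>)))"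
    proof -
      have nonneg: "0 \<le> coin_avg N (\<lambda>\<omega>. of_bool (Q (case_nat b \<omega>)))" for b
        using coin_avg_mono[of "\<lambda>_. 0" "\<lambda>\<omega>. of_bool (Q (case_nat b \<omega>))" N] by simp
      have "(\<integral>\<^sup>+b. emeasure coin_tapes {\<omega>. Q (case_nat b \<omega>)} \<partial>?B) =
          ennreal (coin_avg N (\<lambda>\<omega>. of_bool (Q (case_nat True \<omega>)))) * ennreal (1/2) +
          ennreal (coin_avg N (\<lambda>\<omega>. of_bool (Q (case_nat False \<omega>)))) * ennreal (1 - 1/2)"
        by (subst nn_integral_bernoulli_pmf)
          (simp_all only: coins.P.emeasure_eq_measure[folded coin_tapes_def] meas_b, auto)
      also have "\<dots> = ennreal (coin_avg N (\<lambda>\<omega>. of_bool (Q (case_nat True \<omega>))) * (1/2) +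
          coin_avg N (\<lambda>\<omega>. of_bool (Q (case_nat False \<omega>))) * (1 - 1/2))"
        using nonneg by (subst ennreal_plus) (auto simp only: ennreal_mult, auto)
      finally show ?thesis by (simp add: add_divide_distrib)
    qed
    finally have "measure coin_tapes {\<omega>. Q \<omega>} = coin_avg (Suc N) (\<lambda>\<omega>. of_bool (Q \<omega>))"
      using coin_avg_mono[of "\<lambda>_. 0" "\<lambda>\<omega>. of_bool (Q \<omega>)" "Suc N"]
      by (simp add: measure_def)
    with sets show ?case by blast
  qed
  then show "{\<omega>. Q \<omega>} \<in> sets coin_tapes"
    and "measure coin_tapes {\<omega>. Q \<omega>} = coin_avg N (\<lambda>\<omega>. of_bool (Q \<omega>))" by auto
qed

section \<open>Lower bounds for the optima\<close>

lemma edist_nonneg: "0 \<le> edist d u v"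
  by (simp add: edist_def L2_set_nonneg)

lemma edist_refl [simp]: "edist d u u = 0"
  by (simp add: edist_def L2_set_def)

lemma edist_sym: "edist d u v = edist d v u"
  by (simp add: edist_def L2_set_def power2_commute)

lemma edist_triangle: "edist d u w \<le> edist d u v + edist d v w"
proof -
  have "edist d u w = L2_set (\<lambda>i. (u i - v i) + (v i - w i)) {..<d}"
    by (simp add: edist_def)
  also have "\<dots> \<le> edist d u v + edist d v w"
    unfolding edist_def by (rule L2_set_triangle_ineq)
  finally show ?thesis .
qed

lemma edist_square: "(edist d u v)\<^sup>2 = (\<Sum>i<d. (u i - v i)\<^sup>2)"
  by (simp add: edist_def L2_set_def sum_nonneg)

lemma center_cost_le:
  assumes "finite P" "P \<noteq> {}" "finite T" and "\<And>v. v \<in> P \<Longrightarrow> \<exists>u\<in>T. edist d v u \<le> r"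
  shows "center_cost d P T \<le> r"
  unfolding center_cost_def
proof (rule Max.boundedI)
  fix x assume "x \<in> (\<lambda>v. Min ((\<lambda>u. edist d v u) ` T)) ` P"
  then obtain v where v: "v \<in> P" "x = Min ((\<lambda>u. edist d v u) ` T)" by blast
  with assms(4) obtain u where "u \<in> T" "edist d v u \<le> r" by blast
  with v assms(3) show "x \<le> r" by (auto intro: Min.coboundedI order_trans)
qed (use assms in auto)

lemma center_cost_attained:
  assumes "finite P" "finite T" "T \<noteq> {}" "v \<in> P"
  obtains u where "u \<in> T" "edist d v u \<le> center_cost d P T"
proof -
  have "Min ((\<lambda>u. edist d v u) ` T) \<in> (\<lambda>u. edist d v u) ` T"
    using assms by (intro Min_in) auto
  moreover have "Min ((\<lambda>u. edist d v u) ` T) \<le> center_cost d P T"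
    unfolding center_cost_def using assms by (intro Max.coboundedI) auto
  ultimately show ?thesis using that by auto
qed

lemma diam_cost_le:
  assumes "finite Q" "Q \<noteq> {}" "\<And>A. A \<in> Q \<Longrightarrow> finite A \<and> A \<noteq> {}"
    and "\<And>A u v. A \<in> Q \<Longrightarrow> u \<in> A \<Longrightarrow> v \<in> A \<Longrightarrow> edist d u v \<le> r"
  shows "diam_cost d Q \<le> r"
  unfolding diam_cost_def
  by (rule Max.boundedI) (use assms in \<open>auto intro!: Max.boundedI\<close>)

lemma le_diam_cost:
  assumes "finite Q" "A \<in> Q" "finite A" "u \<in> A" "v \<in> A"
  shows "edist d u v \<le> diam_cost d Q"
proof -
  have "edist d u v \<le> Max ((\<lambda>(u, v). edist d u v) ` (A \<times> A))"
    using assms by (intro Max.coboundedI) auto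
  also have "\<dots> \<le> diam_cost d Q"
    unfolding diam_cost_def using assms by (intro Max.coboundedI) auto
  finally show ?thesis .
qed

definition separated :: "nat \<Rightarrow> real \<Rightarrow> (nat \<Rightarrow> real) set \<Rightarrow> bool" where
  "separated d r S \<longleftrightarrow> (\<forall>u\<in>S. \<forall>v\<in>S. u \<noteq> v \<longrightarrow> r \<le> edist d u v)"

text \<open>Pigeonhole against an arbitrary competitor \<open>T\<close>: assign to each point of
  \<open>S\<close> a center within the cost of \<open>T\<close>. Two points share a center, and the
  triangle inequality through it costs the factor 2.\<close>

lemma separated_le_opt_center:
  assumes P: "finite P" "P \<subseteq> topspace (Euclidean_space d)"
    and S: "S \<subseteq> P" "l < card S" "separated d r S" and l: "0 < l"
  shows "r \<le> 2 * opt_center d P l"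
proof -
  have "r / 2 \<le> opt_center d P l"
    unfolding opt_center_def
  proof (rule cInf_greatest)
    \<comment> \<open>An infimum of reals is bounded below this way only over a nonempty set;
      \<open>l\<close> points of \<open>S\<close> itself serve as a feasible choice of
      centers.\<close>
    obtain T where "T \<subseteq> S" "card T = l" "finite T"
      using S(2) obtain_subset_with_card_n[of l S] by auto
    then show "{center_cost d P T |T. T \<subseteq> topspace (Euclidean_space d) \<and> finite T \<and> card T = l} \<noteq> {}"
      using P S(1) by blast
  next
    fix x assume "x \<in> {center_cost d P T |T. T \<subseteq> topspace (Euclidean_space d) \<and> finite T \<and> card T = l}"
    then obtain T where x: "x = center_cost d P T" and T: "finite T" "card T = l" by blast
    then have "T \<noteq> {}" using l by auto
    then have "\<forall>v\<in>S. \<exists>u\<in>T. edist d v u \<le> x"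
      using center_cost_attained[OF P(1) T(1)] S(1) x by (metis subsetD)
    then obtain f where f: "\<And>v. v \<in> S \<Longrightarrow> f v \<in> T \<and> edist d v (f v) \<le> x" by metis
    then have "card (f ` S) \<le> card T" using T by (intro card_mono) auto
    then have "\<not> inj_on f S" using S(2) T(2) card_image[of f S] by auto
    then obtain u v where uv: "u \<in> S" "v \<in> S" "u \<noteq> v" "f u = f v" by (auto simp: inj_on_def)
    have "r \<le> edist d u v" using S(3) uv by (auto simp: separated_def)
    also have "\<dots> \<le> edist d u (f u) + edist d v (f v)"
      using edist_triangle[of d u v "f u"] uv(4) edist_sym[of d "f u" v] by simp
    also have "\<dots> \<le> 2 * x" using f[of u] f[of v] uv by simp
    finally show "r / 2 \<le> x" by simp
  qed
  then show ?thesis by simp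
qed

text \<open>Two points of \<open>S\<close> fall into one class of any competing partition. The
  partition \<open>Q0\<close> makes the set under \<open>Min\<close> nonempty; the one supplied
  later is the algorithm's own output.\<close>

lemma separated_le_opt_diam:
  assumes P: "finite P" and ex: "partition_on P Q0" "card Q0 = l"
    and S: "S \<subseteq> P" "l < card S" "separated d r S"
  shows "r \<le> opt_diam d P l"
  unfolding opt_diam_def
proof (rule Min.boundedI)
  have "{diam_cost d Q |Q. partition_on P Q \<and> card Q = l} \<subseteq> diam_cost d ` Pow (Pow P)"
    by (auto simp: partition_on_def)
  then show "finite {diam_cost d Q |Q. partition_on P Q \<and> card Q = l}"
    by (rule finite_subset) (simp add: P)
  show "{diam_cost d Q |Q. partition_on P Q \<and> card Q = l} \<noteq> {}"
    using ex by blast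
  fix x assume "x \<in> {diam_cost d Q |Q. partition_on P Q \<and> card Q = l}"
  then obtain Q where x: "x = diam_cost d Q" and Q: "partition_on P Q" "card Q = l" by blast
  have finQ: "finite Q" using Q(1) P by (meson finite_elements)
  have "\<forall>v\<in>S. \<exists>A\<in>Q. v \<in> A" using Q(1) S(1) by (auto simp: partition_on_def)
  then obtain f where f: "\<And>v. v \<in> S \<Longrightarrow> f v \<in> Q \<and> v \<in> f v" by metis
  then have "card (f ` S) \<le> card Q" using finQ by (intro card_mono) auto
  then have "\<not> inj_on f S" using S(2) Q(2) card_image[of f S] by auto
  then obtain u v where uv: "u \<in> S" "v \<in> S" "u \<noteq> v" "f u = f v" by (auto simp: inj_on_def)
  have "r \<le> edist d u v" using S(3) uv by (auto simp: separated_def)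
  also have "\<dots> \<le> x"
  proof -
    have "finite (f u)" using f[of u] uv(1) Q(1) P by (auto simp: partition_on_def intro: finite_subset)
    then show ?thesis unfolding x using f[of u] f[of v] uv finQ by (intro le_diam_cost[where A = "f u"]) auto
  qed
  finally show "r \<le> x" .
qed

section \<open>Farthest-first traversal\<close>

text \<open>
  State of the farthest-first traversal after \<open>j\<close> choices \<open>cs 0, \<dots>, cs (j - 1)\<close>: \<open>D i\<close> is the
  distance of \<open>i\<close> to the nearest choice, \<open>lab i\<close> the number of that choice. The value \<open>-1\<close> marks
  the chosen indices, so that the \<open>l\<close> choices are distinct even if \<open>\<delta>\<close> degenerates.
\<close>

definition farthest_first ::
  "nat \<Rightarrow> (nat \<Rightarrow> nat \<Rightarrow> real) \<Rightarrow> nat \<Rightarrow> (nat \<Rightarrow> nat) \<Rightarrow> (nat \<Rightarrow> real) \<Rightarrow> (nat \<Rightarrow> nat) \<Rightarrow> bool" where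
  "farthest_first n \<delta> j cs D lab \<longleftrightarrow>
    inj_on cs {..<j} \<and> cs ` {..<j} \<subseteq> {..<n} \<and>
    (\<forall>a<j. D (cs a) = -1 \<and> lab (cs a) = a) \<and>
    (\<forall>i<n. i \<notin> cs ` {..<j} \<longrightarrow> 0 \<le> D i \<and>
      (0 < j \<longrightarrow> lab i < j \<and> D i = \<delta> i (cs (lab i))) \<and>
      (\<forall>a<j. D i \<le> \<delta> i (cs a)) \<and>
      (\<forall>a<j. \<forall>b<j. a \<noteq> b \<longrightarrow> D i \<le> \<delta> (cs a) (cs b)))"

lemma farthest_first_0: "(\<And>i. D i = 0) \<Longrightarrow> farthest_first n \<delta> 0 cs D lab"
  by (simp add: farthest_first_def)

text \<open>The delicate part of the invariant is that every open value stays below all distances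
  between chosen indices. For the new index \<open>c\<close> this follows from its being farthest:
  \<open>D i \<le> D c \<le> \<delta> c (cs a)\<close>. In the first round there is no distance to
  compare with, hence the tests \<open>j = 0\<close>.\<close>

lemma farthest_first_Suc:
  assumes ff: "farthest_first n \<delta> j cs D lab" and j: "j < n"
    and c: "c < n" "\<And>i. i < n \<Longrightarrow> D i \<le> D c"
    and \<delta>: "\<And>a b. 0 \<le> \<delta> a b" "\<And>a b. \<delta> a b = \<delta> b a"
    and D': "\<And>i. i < n \<Longrightarrow> D' i = (if i = c then -1 else if j = 0 \<or> \<delta> i c < D i then \<delta> i c else D i)"
    and lab': "\<And>i. i < n \<Longrightarrow> lab' i = (if i = c \<or> j = 0 \<or> \<delta> i c < D i then j else lab i)"
  shows "farthest_first n \<delta> (Suc j) (cs(j := c)) D' lab'"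
proof -
  have inj: "inj_on cs {..<j}" and sub: "cs ` {..<j} \<subseteq> {..<n}"
    and chosen: "\<And>a. a < j \<Longrightarrow> D (cs a) = -1 \<and> lab (cs a) = a"
    and open_: "\<And>i. i < n \<Longrightarrow> i \<notin> cs ` {..<j} \<Longrightarrow> 0 \<le> D i \<and>
      (0 < j \<longrightarrow> lab i < j \<and> D i = \<delta> i (cs (lab i))) \<and>
      (\<forall>a<j. D i \<le> \<delta> i (cs a)) \<and>
      (\<forall>a<j. \<forall>b<j. a \<noteq> b \<longrightarrow> D i \<le> \<delta> (cs a) (cs b))"
    using ff unfolding farthest_first_def by blast+
  have "card (cs ` {..<j}) < card {..<n}"
    using j card_image_le[of "{..<j}" cs] by simp
  then have "cs ` {..<j} \<noteq> {..<n}" by auto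
  then obtain z where "z < n" "z \<notin> cs ` {..<j}" using sub by auto
  \<comment> \<open>Some index \<open>z\<close> is still open and has a nonnegative value, so the
    maximum \<open>D c\<close> lies above the mark \<open>-1\<close>; hence \<open>c\<close> has not
    been chosen before.\<close>
  then have "0 \<le> D c" using open_[of z] c(2)[of z] by simp
  then have c_new: "c \<notin> cs ` {..<j}" using chosen by force
  have img: "(cs(j := c)) ` {..<Suc j} = insert c (cs ` {..<j})"
    by (auto simp: less_Suc_eq)
  have cs_ne: "cs a \<noteq> c" and cs_lt: "cs a < n" if "a < j" for a using that c_new sub by auto
  show ?thesis
    unfolding farthest_first_def img
  proof (intro conjI allI impI)
    show "inj_on (cs(j := c)) {..<Suc j}"
      using inj c_new by (auto simp: inj_on_def less_Suc_eq)
    show "insert c (cs ` {..<j}) \<subseteq> {..<n}" using sub c(1) by simp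
  next
    fix a assume a: "a < Suc j"
    show "D' ((cs(j := c)) a) = -1"
    proof (cases "a = j")
      case False
      \<comment> \<open>A mark \<open>-1\<close> survives the update since \<open>\<delta>\<close>
        is nonnegative, and \<open>a < j\<close> excludes the first-round case.\<close>
      then show ?thesis using a chosen[of a] \<delta>(1)[of "cs a" c] by (simp add: D' cs_lt)
    qed (simp add: D' c(1))
    show "lab' ((cs(j := c)) a) = a"
    proof (cases "a = j")
      case False
      then show ?thesis using a chosen[of a] \<delta>(1)[of "cs a" c] cs_ne[of a] by (simp add: lab' cs_lt)
    qed (simp add: lab' c(1))
  next
    fix i assume i: "i < n" and "i \<notin> insert c (cs ` {..<j})"
    then have ic: "i \<noteq> c" and inot: "i \<notin> cs ` {..<j}" by auto
    note o = open_[OF i inot]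
    have D'i: "D' i = (if j = 0 \<or> \<delta> i c < D i then \<delta> i c else D i)" using ic i by (simp add: D')
    have D'_le: "j \<noteq> 0 \<Longrightarrow> D' i \<le> D i" by (simp add: D'i)
    show "0 \<le> D' i" using o \<delta>(1) by (simp add: D'i)
    show "lab' i < Suc j" using o i by (auto simp: lab')
    show "D' i = \<delta> i ((cs(j := c)) (lab' i))" using o ic i by (auto simp: D'i lab')
    show "D' i \<le> \<delta> i ((cs(j := c)) a)" if a: "a < Suc j" for a
    proof (cases "a = j")
      case False
      then have "a < j" using a by simp
      then have "D i \<le> \<delta> i (cs a)" using o by blast
      then show ?thesis using D'_le \<open>a < j\<close> by fastforce
    qed (use D'i in auto)
    have new: "D' i \<le> \<delta> (cs a) c" if "a < j" for a
    proof -
      have "D' i \<le> D i" using D'_le that by simp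
      also have "\<dots> \<le> D c" using c(2) i by simp
      also have "\<dots> \<le> \<delta> c (cs a)" using open_[OF c(1) c_new] that by blast
      finally show ?thesis using \<delta>(2) by simp
    qed
    show "D' i \<le> \<delta> ((cs(j := c)) a) ((cs(j := c)) b)" if ab: "a < Suc j" "b < Suc j" "a \<noteq> b" for a b
    proof -
      consider "a < j" "b < j" | "a < j" "b = j" | "a = j" "b < j" using ab by linarith
      then show ?thesis
      proof cases
        case 1
        then have "D i \<le> \<delta> (cs a) (cs b)" using o ab(3) by blast
        then show ?thesis using 1 D'_le by fastforce
      next
        case 2
        then show ?thesis using new by simp
      next
        case 3
        then show ?thesis using new \<delta>(2) by simp
      qed
    qed
  qed
qed

text \<open>\<open>R\<close> is the largest value among the open indices and \<open>z\<close>
  attains it, so the invariant at \<open>z\<close> is the separation claim. The disjunct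
  \<open>cs (lab i) = i\<close> handles chosen indices, for which \<open>\<delta> i i = 0\<close> is
  not assumed.\<close>

lemma farthest_first_radius:
  assumes ff: "farthest_first n \<delta> l cs D lab" and l: "0 < l" "l < n"
    and \<delta>: "\<And>a b. \<delta> a b = \<delta> b a"
  obtains R z where "0 \<le> R" "z < n" "z \<notin> cs ` {..<l}"
    and "\<And>a b. a \<in> insert z (cs ` {..<l}) \<Longrightarrow> b \<in> insert z (cs ` {..<l}) \<Longrightarrow> a \<noteq> b \<Longrightarrow> R \<le> \<delta> a b"
    and "\<And>i. i < n \<Longrightarrow> cs (lab i) = i \<or> \<delta> i (cs (lab i)) \<le> R"
proof -
  define U where "U = {..<n} - cs ` {..<l}"
  have sub: "cs ` {..<l} \<subseteq> {..<n}" using ff by (simp add: farthest_first_def)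
  have "card (cs ` {..<l}) < card {..<n}"
    using l card_image_le[of "{..<l}" cs] by simp
  then have "cs ` {..<l} \<noteq> {..<n}" by auto
  then have "U \<noteq> {}" unfolding U_def using sub by auto
  moreover have "finite U" by (simp add: U_def)
  ultimately have "Max (D ` U) \<in> D ` U" by (intro Max_in) auto
  then obtain z where z: "z \<in> U" "D z = Max (D ` U)" by auto
  have max: "D i \<le> D z" if "i \<in> U" for i
    unfolding z(2) using that \<open>finite U\<close> by (intro Max_ge) auto
  have open_: "0 \<le> D i" "D i = \<delta> i (cs (lab i))" "\<And>a. a < l \<Longrightarrow> D i \<le> \<delta> i (cs a)"
      "\<And>a b. a < l \<Longrightarrow> b < l \<Longrightarrow> a \<noteq> b \<Longrightarrow> D i \<le> \<delta> (cs a) (cs b)" if "i \<in> U" for i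
  proof -
    have "i < n" "i \<notin> cs ` {..<l}" using that by (auto simp: U_def)
    then have "0 \<le> D i \<and> (0 < l \<longrightarrow> lab i < l \<and> D i = \<delta> i (cs (lab i))) \<and>
      (\<forall>a<l. D i \<le> \<delta> i (cs a)) \<and> (\<forall>a<l. \<forall>b<l. a \<noteq> b \<longrightarrow> D i \<le> \<delta> (cs a) (cs b))"
      using ff unfolding farthest_first_def by blast
    with l(1) show "0 \<le> D i" "D i = \<delta> i (cs (lab i))" "\<And>a. a < l \<Longrightarrow> D i \<le> \<delta> i (cs a)"
      "\<And>a b. a < l \<Longrightarrow> b < l \<Longrightarrow> a \<noteq> b \<Longrightarrow> D i \<le> \<delta> (cs a) (cs b)"
      by blast+
  qed
  show ?thesis
  proof (rule that[of "D z" z])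
    show "0 \<le> D z" using open_(1)[OF z(1)] .
    show "z < n" "z \<notin> cs ` {..<l}" using z(1) by (auto simp: U_def)
    show "D z \<le> \<delta> a b" if "a \<in> insert z (cs ` {..<l})" "b \<in> insert z (cs ` {..<l})" "a \<noteq> b" for a b
      using that open_(3,4)[OF z(1)] \<delta> by auto
    show "cs (lab i) = i \<or> \<delta> i (cs (lab i)) \<le> D z" if "i < n" for i
    proof (cases "i \<in> U")
      case True
      then show ?thesis using open_(2)[OF True] max by metis
    next
      case False
      then obtain a where "a < l" "i = cs a" using \<open>i < n\<close> by (auto simp: U_def)
      then show ?thesis using ff by (simp add: farthest_first_def)
    qed
  qed
qed

lemma farthest_first_lab:
  assumes "farthest_first n \<delta> l cs D lab" "0 < l" "i < n"
  shows "lab i < l"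
proof (cases "i \<in> cs ` {..<l}")
  case True
  then show ?thesis using assms by (auto simp: farthest_first_def)
next
  case False
  then show ?thesis using assms by (simp add: farthest_first_def)
qed

definition centers :: "nat \<Rightarrow> (nat \<Rightarrow> nat \<Rightarrow> real) \<Rightarrow> (nat \<Rightarrow> nat) \<Rightarrow> (nat \<Rightarrow> real) set" where
  "centers l p cs = p ` cs ` {..<l}"

definition clusters ::
  "nat \<Rightarrow> nat \<Rightarrow> (nat \<Rightarrow> nat \<Rightarrow> real) \<Rightarrow> (nat \<Rightarrow> nat) \<Rightarrow> (nat \<Rightarrow> real) set set" where
  "clusters n l p lab = (\<lambda>k. {p j | j. j < n \<and> lab j = k}) ` {..<l}"

lemma centers_valid:
  assumes "clustering_instance n d l \<epsilon> p" and "farthest_first n \<delta> l cs D lab"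
  shows "centers l p cs \<subseteq> p ` {..<n}" and "card (centers l p cs) = l"
proof -
  have "inj_on cs {..<l}" "cs ` {..<l} \<subseteq> {..<n}" "inj_on p {..<n}"
    using assms by (simp_all add: farthest_first_def clustering_instance_def)
  then show "centers l p cs \<subseteq> p ` {..<n}" "card (centers l p cs) = l"
    by (auto simp: centers_def card_image inj_on_subset)
qed

text \<open>Holds for every \<open>\<delta>\<close>, hence on every coin tape. Class
  \<open>k\<close> contains its center because \<open>lab (cs k) = k\<close>, so no class is empty;
  injectivity of \<open>p\<close> keeps different classes disjoint.\<close>

lemma clusters_valid:
  assumes inst: "clustering_instance n d l \<epsilon> p" and ff: "farthest_first n \<delta> l cs D lab"
  shows "partition_on (p ` {..<n}) (clusters n l p lab)" and "card (clusters n l p lab) = l"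
proof -
  have l: "0 < l" and inj: "inj_on p {..<n}" using inst by (simp_all add: clustering_instance_def)
  have cs: "cs k < n" "lab (cs k) = k" if "k < l" for k
    using ff that by (auto simp: farthest_first_def)
  have lab: "lab i < l" if "i < n" for i using farthest_first_lab[OF ff l that] .
  define F where "F k = {p j | j. j < n \<and> lab j = k}" for k
  have mem: "p (cs k) \<in> F k" if "k < l" for k using cs[OF that] by (auto simp: F_def)
  have disj: "k = k'" if "x \<in> F k" "x \<in> F k'" for k k' x
    using that inj by (auto simp: F_def inj_on_def)
  have Q: "clusters n l p lab = F ` {..<l}" by (simp add: clusters_def F_def)
  show "partition_on (p ` {..<n}) (clusters n l p lab)"
    unfolding Q
  proof (rule partition_onI)
    show "\<Union> (F ` {..<l}) = p ` {..<n}" using lab by (auto simp: F_def)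
    show "{} \<notin> F ` {..<l}" using mem by auto
    show "disjnt A B" if AB: "A \<in> F ` {..<l}" "B \<in> F ` {..<l}" "A \<noteq> B" for A B
    proof -
      obtain k k' where "A = F k" "B = F k'" using AB(1,2) by blast
      then show ?thesis using AB(3) disj[of _ k k'] unfolding disjnt_iff by blast
    qed
  qed
  have "inj_on F {..<l}" using mem disj by (metis inj_onI lessThan_iff)
  then show "card (clusters n l p lab) = l" unfolding Q by (simp add: card_image)
qed

text \<open>The sketched radius \<open>R\<close> is translated into a true length \<open>r\<close>
  such that \<open>R \<le> \<delta> a b\<close> forces distance at least \<open>r\<close> and
  \<open>\<delta> a b \<le> R\<close> forces distance at most
  \<open>(1 + \<epsilon>/2) * r\<close>.\<close>

lemma farthest_first_approx:
  assumes inst: "clustering_instance n d l \<epsilon> p" and ff: "farthest_first n \<delta> l cs D lab"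
    and sym: "\<And>a b. \<delta> a b = \<delta> b a" and K: "0 < K"
    and distortion: "\<And>a b. a < n \<Longrightarrow> b < n \<Longrightarrow>
      \<bar>\<delta> a b - K * (edist d (p a) (p b))\<^sup>2\<bar> \<le> \<epsilon> / 4 * K * (edist d (p a) (p b))\<^sup>2"
  shows "center_cost d (p ` {..<n}) (centers l p cs) \<le> (2 + \<epsilon>) * opt_center d (p ` {..<n}) l"
    and "diam_cost d (clusters n l p lab) \<le> (2 + \<epsilon>) * opt_diam d (p ` {..<n}) l"
proof -
  have l: "0 < l" "l < n" and \<epsilon>: "0 < \<epsilon>" "\<epsilon> < 1/2"
    and P: "p ` {..<n} \<subseteq> topspace (Euclidean_space d)" and inj: "inj_on p {..<n}"
    using inst by (simp_all add: clustering_instance_def)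
  have cs: "inj_on cs {..<l}" "cs ` {..<l} \<subseteq> {..<n}"
    using ff by (simp_all add: farthest_first_def)
  obtain R z where R: "0 \<le> R" and z: "z < n" "z \<notin> cs ` {..<l}"
    and sep: "\<And>a b. a \<in> insert z (cs ` {..<l}) \<Longrightarrow> b \<in> insert z (cs ` {..<l}) \<Longrightarrow> a \<noteq> b \<Longrightarrow> R \<le> \<delta> a b"
    and cover: "\<And>i. i < n \<Longrightarrow> cs (lab i) = i \<or> \<delta> i (cs (lab i)) \<le> R"
    using farthest_first_radius[OF ff l sym] by blast
  \<comment> \<open>The smallest true distance compatible with a sketched value \<open>R\<close>, if
    squares are stretched by \<open>K\<close> and then by at most
    \<open>1 + \<epsilon>/4\<close>.\<close>
  define r where "r = sqrt (R / ((1 + \<epsilon>/4) * K))"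
  have r: "0 \<le> r" using R K \<epsilon> by (simp add: r_def)
  have r2: "r\<^sup>2 = R / ((1 + \<epsilon>/4) * K)" using R K \<epsilon> by (simp add: r_def)
  have far: "r \<le> edist d (p a) (p b)" if "R \<le> \<delta> a b" "a < n" "b < n" for a b
  proof -
    have "R \<le> (1 + \<epsilon>/4) * K * (edist d (p a) (p b))\<^sup>2"
      using distortion[OF that(2,3)] that(1) unfolding abs_le_iff by (simp add: algebra_simps)
    then have "r\<^sup>2 \<le> (edist d (p a) (p b))\<^sup>2"
      unfolding r2 using K \<epsilon> by (simp add: divide_simps mult_ac)
    then show ?thesis using edist_nonneg power2_le_imp_le by blast
  qed
  have near: "edist d (p a) (p b) \<le> (1 + \<epsilon>/2) * r" if "\<delta> a b \<le> R" "a < n" "b < n" for a b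
  proof -
    have "(1 - \<epsilon>/4) * K * (edist d (p a) (p b))\<^sup>2 \<le> R"
      using distortion[OF that(2,3)] that(1) unfolding abs_le_iff by (simp add: algebra_simps)
    also have "R = (1 + \<epsilon>/4) * K * r\<^sup>2" unfolding r2 using K \<epsilon> by simp
    \<comment> \<open>The choice of distortion \<open>\<epsilon>/4\<close> is justified here:
      \<open>(1 + \<epsilon>/4) / (1 - \<epsilon>/4)\<close> is at most the square of
      \<open>1 + \<epsilon>/2\<close>.\<close>
    also have "\<dots> \<le> ((1 - \<epsilon>/4) * (1 + \<epsilon>/2)\<^sup>2) * K * r\<^sup>2"
    proof (intro mult_right_mono)
      have "(1 - \<epsilon>/4) * (1 + \<epsilon>/2)\<^sup>2 - (1 + \<epsilon>/4) = \<epsilon> * (1/2 - \<epsilon>\<^sup>2/16)"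
        by (simp add: power2_eq_square field_simps)
      moreover have "\<epsilon>\<^sup>2 \<le> 1" using \<epsilon> by (simp add: power_le_one)
      then have "0 \<le> \<epsilon> * (1/2 - \<epsilon>\<^sup>2/16)" using \<epsilon> by simp
      ultimately show "1 + \<epsilon>/4 \<le> (1 - \<epsilon>/4) * (1 + \<epsilon>/2)\<^sup>2" by linarith
    qed (use K in auto)
    finally have "(1 - \<epsilon>/4) * K * (edist d (p a) (p b))\<^sup>2 \<le> (1 - \<epsilon>/4) * K * ((1 + \<epsilon>/2) * r)\<^sup>2"
      by (simp add: power_mult_distrib mult_ac)
    moreover have "0 < (1 - \<epsilon>/4) * K" using \<epsilon> K by simp
    ultimately have "(edist d (p a) (p b))\<^sup>2 \<le> ((1 + \<epsilon>/2) * r)\<^sup>2" by (rule mult_left_le_imp_le)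
    then show ?thesis by (rule power2_le_imp_le) (use \<epsilon> r in auto)
  qed
  have near_center: "edist d (p i) (p (cs (lab i))) \<le> (1 + \<epsilon>/2) * r" if "i < n" for i
  proof (cases "cs (lab i) = i")
    case True
    then show ?thesis using \<epsilon> r by simp
  next
    case False
    moreover have "cs (lab i) < n" using farthest_first_lab[OF ff l(1) that] cs(2) by auto
    ultimately show ?thesis using near that cover by blast
  qed
  define S where "S = p ` insert z (cs ` {..<l})"
  have S_sub: "S \<subseteq> p ` {..<n}" using z cs(2) by (auto simp: S_def)
  have "insert z (cs ` {..<l}) \<subseteq> {..<n}" using z cs(2) by simp
  then have "card S = card (insert z (cs ` {..<l}))"
    unfolding S_def by (rule card_image[OF inj_on_subset[OF inj]])
  also have "\<dots> = Suc l" using z cs(1) by (simp add: card_image)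
  finally have S_card: "l < card S" by simp
  have S_sep: "separated d r S"
    unfolding separated_def
  proof (intro ballI impI)
    fix u v assume u: "u \<in> S" and v: "v \<in> S" and "u \<noteq> v"
    obtain a where a: "u = p a" "a \<in> insert z (cs ` {..<l})"
      using u unfolding S_def by (rule imageE)
    obtain b where b: "v = p b" "b \<in> insert z (cs ` {..<l})"
      using v unfolding S_def by (rule imageE)
    have "R \<le> \<delta> a b" using sep[OF a(2) b(2)] \<open>u \<noteq> v\<close> a(1) b(1) by blast
    moreover have "a < n" "b < n" using a(2) b(2) z cs(2) by auto
    ultimately show "r \<le> edist d u v" unfolding a(1) b(1) by (rule far)
  qed
  have opt_center: "r \<le> 2 * opt_center d (p ` {..<n}) l"
    by (rule separated_le_opt_center[OF _ P S_sub S_card S_sep l(1)]) simp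
  have opt_diam: "r \<le> opt_diam d (p ` {..<n}) l"
    by (rule separated_le_opt_diam[OF _ clusters_valid[OF inst ff] S_sub S_card S_sep]) simp
  have "center_cost d (p ` {..<n}) (centers l p cs) \<le> (1 + \<epsilon>/2) * r"
  proof (rule center_cost_le)
    fix v assume "v \<in> p ` {..<n}"
    then obtain i where i: "i < n" "v = p i" by auto
    have "p (cs (lab i)) \<in> centers l p cs"
      using farthest_first_lab[OF ff l(1) i(1)] by (auto simp: centers_def)
    then show "\<exists>u\<in>centers l p cs. edist d v u \<le> (1 + \<epsilon>/2) * r"
      using near_center[OF i(1)] i(2) by blast
  qed (use l in \<open>auto simp: centers_def\<close>)
  also have "\<dots> \<le> (1 + \<epsilon>/2) * (2 * opt_center d (p ` {..<n}) l)"
    using opt_center \<epsilon> by (intro mult_left_mono) auto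
  finally show "center_cost d (p ` {..<n}) (centers l p cs) \<le> (2 + \<epsilon>) * opt_center d (p ` {..<n}) l"
    by (simp add: algebra_simps)
  \<comment> \<open>The factor 2 moves: for centers it comes from
    \<open>r \<le> 2 * opt_center\<close>, here from passing through the common center of two
    points, while \<open>r \<le> opt_diam\<close> carries no factor.\<close>
  have "diam_cost d (clusters n l p lab) \<le> 2 * ((1 + \<epsilon>/2) * r)"
  proof (rule diam_cost_le)
    fix A u v assume "A \<in> clusters n l p lab" "u \<in> A" "v \<in> A"
    then obtain i j where ij: "i < n" "j < n" "u = p i" "v = p j" "lab i = lab j"
      unfolding clusters_def by auto
    have "edist d u v \<le> edist d u (p (cs (lab i))) + edist d v (p (cs (lab j)))"
      using edist_triangle[of d u v "p (cs (lab i))"] edist_sym[of d v] ij(5) by simp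
    also have "\<dots> \<le> 2 * ((1 + \<epsilon>/2) * r)"
      using near_center[OF ij(1)] near_center[OF ij(2)] ij(3,4) by simp
    finally show "edist d u v \<le> 2 * ((1 + \<epsilon>/2) * r)" .
  next
    fix A assume "A \<in> clusters n l p lab"
    then show "finite A \<and> A \<noteq> {}"
      using clusters_valid(1)[OF inst ff] by (auto simp: partition_on_def clusters_def)
  qed (use l in \<open>auto simp: clusters_def\<close>)
  also have "\<dots> = (2 + \<epsilon>) * r" by (simp add: algebra_simps)
  also have "\<dots> \<le> (2 + \<epsilon>) * opt_diam d (p ` {..<n}) l"
    using opt_diam \<epsilon> by (intro mult_left_mono) auto
  finally show "diam_cost d (clusters n l p lab) \<le> (2 + \<epsilon>) * opt_diam d (p ` {..<n}) l" .
qed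

section \<open>Reasoning about programs\<close>

lemma val_coins [simp]:
  shows nval_coins: "nval e (s\<lparr>coins := w\<rparr>) = nval e s"
    and rval_coins: "rval r (s\<lparr>coins := w\<rparr>) = rval r s"
    and bval_coins: "bval b (s\<lparr>coins := w\<rparr>) = bval b s"
proof -
  show n: "nval e (s\<lparr>coins := w\<rparr>) = nval e s" for e by (induction e) auto
  show r: "rval r (s\<lparr>coins := w\<rparr>) = rval r s" for r by (induction r) (auto simp: n)
  show "bval b (s\<lparr>coins := w\<rparr>) = bval b s" by (induction b) (auto simp: n r)
qed

text \<open>Here \<open>m\<close> is the number of tosses read. It is at most \<open>t\<close>
  because each \<open>Flip\<close> costs at least one unit, and unread bits cannot influence the
  run.\<close>

lemma exec_coins:
  "exec c s t s' \<Longrightarrow> \<exists>m\<le>t. coins s' = (\<lambda>i. coins s (i + m)) \<and>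
    (\<forall>w. (\<forall>i<m. w i = coins s i) \<longrightarrow> exec c (s\<lparr>coins := w\<rparr>) t (s'\<lparr>coins := \<lambda>i. w (i + m)\<rparr>))"
proof (induction rule: exec.induct)
  case (Skip s)
  show ?case using exec.Skip by (intro exI[of _ 0]) auto
next
  case (NStore g a e s)
  have swap: "s\<lparr>coins := w, nmem := x\<rparr> = s\<lparr>nmem := x, coins := w\<rparr>" for w x by simp
  have "exec (NStore g a e) (s\<lparr>coins := w\<rparr>) t (s\<lparr>nmem := x, coins := w\<rparr>)"
    if "x = (nmem s)(g := (nmem s g)(nval a s := nval e s))" and "t = 1 + ncost a + ncost e" for w x t
    unfolding swap[symmetric] using exec.NStore[of g a e "s\<lparr>coins := w\<rparr>"] that by simp
  then show ?case by (intro exI[of _ 0]) auto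
next
  case (RStore g a e s)
  have swap: "s\<lparr>coins := w, rmem := x\<rparr> = s\<lparr>rmem := x, coins := w\<rparr>" for w x by simp
  have "exec (RStore g a e) (s\<lparr>coins := w\<rparr>) t (s\<lparr>rmem := x, coins := w\<rparr>)"
    if "x = (rmem s)(g := (rmem s g)(nval a s := rval e s))" and "t = 1 + ncost a + rcost e" for w x t
    unfolding swap[symmetric] using exec.RStore[of g a e "s\<lparr>coins := w\<rparr>"] that by simp
  then show ?case by (intro exI[of _ 0]) auto
next
  case (Flip g a s)
  have "exec (Flip g a) (s\<lparr>coins := w\<rparr>) (1 + ncost a)
      (s\<lparr>nmem := (nmem s)(g := (nmem s g)(nval a s := of_bool (coins s 0))),
         coins := \<lambda>i. w (i + 1)\<rparr>)" if "w 0 = coins s 0" for w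
    using exec.Flip[of g a "s\<lparr>coins := w\<rparr>"] that by simp
  then show ?case by (intro exI[of _ 1]) auto
next
  case (Seq c1 s t1 s' c2 t2 s'')
  then obtain m1 m2 where m1: "m1 \<le> t1" "coins s' = (\<lambda>i. coins s (i + m1))"
      "\<And>w. (\<forall>i<m1. w i = coins s i) \<Longrightarrow> exec c1 (s\<lparr>coins := w\<rparr>) t1 (s'\<lparr>coins := \<lambda>i. w (i + m1)\<rparr>)"
    and m2: "m2 \<le> t2" "coins s'' = (\<lambda>i. coins s' (i + m2))"
      "\<And>w. (\<forall>i<m2. w i = coins s' i) \<Longrightarrow> exec c2 (s'\<lparr>coins := w\<rparr>) t2 (s''\<lparr>coins := \<lambda>i. w (i + m2)\<rparr>)"
    by blast
  show ?case
  proof (intro exI[of _ "m1 + m2"] conjI allI impI)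
    fix w assume w: "\<forall>i<m1 + m2. w i = coins s i"
    show "exec (Seq c1 c2) (s\<lparr>coins := w\<rparr>) (t1 + t2) (s''\<lparr>coins := \<lambda>i. w (i + (m1 + m2))\<rparr>)"
      using exec.Seq[OF m1(3)[of w] m2(3)[of "\<lambda>i. w (i + m1)"]] w
      by (simp add: m1(2) add.commute add.left_commute)
  qed (use m1 m2 in \<open>auto simp: add_ac\<close>)
next
  case (IfTrue b s c1 t s' c2)
  then obtain m where m: "m \<le> t" "coins s' = (\<lambda>i. coins s (i + m))"
      "\<And>w. (\<forall>i<m. w i = coins s i) \<Longrightarrow> exec c1 (s\<lparr>coins := w\<rparr>) t (s'\<lparr>coins := \<lambda>i. w (i + m)\<rparr>)"
    by blast
  with IfTrue(1) show ?case by (intro exI[of _ m]) (auto intro!: exec.IfTrue[simplified])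
next
  case (IfFalse b s c2 t s' c1)
  then obtain m where m: "m \<le> t" "coins s' = (\<lambda>i. coins s (i + m))"
      "\<And>w. (\<forall>i<m. w i = coins s i) \<Longrightarrow> exec c2 (s\<lparr>coins := w\<rparr>) t (s'\<lparr>coins := \<lambda>i. w (i + m)\<rparr>)"
    by blast
  with IfFalse(1) show ?case by (intro exI[of _ m]) (auto intro!: exec.IfFalse[simplified])
next
  case (WhileFalse b s c)
  then show ?case by (intro exI[of _ 0]) (auto intro!: exec.WhileFalse[simplified])
next
  case (WhileTrue b s c t1 s' t2 s'')
  then obtain m1 m2 where m1: "m1 \<le> t1" "coins s' = (\<lambda>i. coins s (i + m1))"
      "\<And>w. (\<forall>i<m1. w i = coins s i) \<Longrightarrow> exec c (s\<lparr>coins := w\<rparr>) t1 (s'\<lparr>coins := \<lambda>i. w (i + m1)\<rparr>)"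
    and m2: "m2 \<le> t2" "coins s'' = (\<lambda>i. coins s' (i + m2))"
      "\<And>w. (\<forall>i<m2. w i = coins s' i) \<Longrightarrow>
        exec (While b c) (s'\<lparr>coins := w\<rparr>) t2 (s''\<lparr>coins := \<lambda>i. w (i + m2)\<rparr>)"
    by blast
  show ?case
  proof (intro exI[of _ "m1 + m2"] conjI allI impI)
    fix w assume w: "\<forall>i<m1 + m2. w i = coins s i"
    show "exec (While b c) (s\<lparr>coins := w\<rparr>) (1 + bcost b + t1 + t2)
        (s''\<lparr>coins := \<lambda>i. w (i + (m1 + m2))\<rparr>)"
      using exec.WhileTrue[OF _ m1(3)[of w] m2(3)[of "\<lambda>i. w (i + m1)"]] w WhileTrue(1)
      by (simp add: m1(2) add.commute add.left_commute)
  qed (use m1 m2 in \<open>auto simp: add_ac\<close>)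
qed

lemma exec_prefix:
  assumes "exec c (s\<lparr>coins := \<omega>\<rparr>) t s'" and "t \<le> N" and "\<And>i. i < N \<Longrightarrow> \<omega> i = \<omega>' i"
  obtains u where "exec c (s\<lparr>coins := \<omega>'\<rparr>) t (s'\<lparr>coins := u\<rparr>)"
proof -
  obtain m where "m \<le> t"
    "\<And>w. (\<forall>i<m. w i = \<omega> i) \<Longrightarrow> exec c (s\<lparr>coins := w\<rparr>) t (s'\<lparr>coins := \<lambda>i. w (i + m)\<rparr>)"
    using exec_coins[OF assms(1)] by auto
  moreover from this(1) have "\<forall>i<m. \<omega>' i = \<omega> i" using assms(2,3) by simp
  ultimately show ?thesis using that by blast
qed

text \<open>A total-correctness triple with a time budget. An upper bound instead of the exact time
  lets all iterations of a loop be charged equally.\<close>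

definition run :: "com \<Rightarrow> state \<Rightarrow> nat \<Rightarrow> (state \<Rightarrow> bool) \<Rightarrow> bool" where
  "run c s T Q \<longleftrightarrow> (\<exists>t s'. exec c s t s' \<and> t \<le> T \<and> Q s')"

lemma run_mono:
  "run c s T Q \<Longrightarrow> T \<le> T' \<Longrightarrow> (\<And>s'. Q s' \<Longrightarrow> Q' s') \<Longrightarrow> run c s T' Q'"
  unfolding run_def by (meson order_trans)

lemma run_Seq:
  assumes "run c1 s T1 R" and "\<And>s'. R s' \<Longrightarrow> run c2 s' T2 Q"
  shows "run (Seq c1 c2) s (T1 + T2) Q"
  using assms unfolding run_def by (meson add_mono exec.Seq)

text \<open>The index \<open>m\<close> of the invariant counts the completed iterations.\<close>

lemma run_While:
  assumes "I 0 s"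
    and "\<And>m s. I m s \<Longrightarrow> bval b s \<Longrightarrow> m < N \<and> run c s T (I (Suc m))"
  shows "run (While b c) s (N * (1 + bcost b + T) + 1 + bcost b)
    (\<lambda>s'. \<exists>m. I m s' \<and> \<not> bval b s')"
proof -
  have "I m s \<Longrightarrow> m \<le> N \<Longrightarrow> run (While b c) s ((N - m) * (1 + bcost b + T) + 1 + bcost b)
    (\<lambda>s'. \<exists>m. I m s' \<and> \<not> bval b s')" for m s
  proof (induction "N - m" arbitrary: m s rule: less_induct)
    case less
    show ?case
    proof (cases "bval b s")
      case True
      then obtain t1 s1 where m: "m < N" and 1: "exec c s t1 s1" "t1 \<le> T" "I (Suc m) s1"
        using assms(2) less.prems unfolding run_def by blast
      have "run (While b c) s1 ((N - Suc m) * (1 + bcost b + T) + 1 + bcost b)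
          (\<lambda>s'. \<exists>m. I m s' \<and> \<not> bval b s')"
        using m 1 less.hyps[of "Suc m" s1] by simp
      then obtain t2 s2 where 2: "exec (While b c) s1 t2 s2"
        "t2 \<le> (N - Suc m) * (1 + bcost b + T) + 1 + bcost b" "\<exists>m. I m s2 \<and> \<not> bval b s2"
        unfolding run_def by blast
      have "N - m = Suc (N - Suc m)" using m by simp
      then have "1 + bcost b + t1 + t2 \<le> (N - m) * (1 + bcost b + T) + 1 + bcost b"
        using 1(2) 2(2) by simp
      with exec.WhileTrue[OF True 1(1) 2(1)] 2(3) show ?thesis
        unfolding run_def by blast
    next
      case False
      then have "exec (While b c) s (1 + bcost b) s" by (rule exec.WhileFalse)
      moreover have "1 + bcost b \<le> (N - m) * (1 + bcost b + T) + 1 + bcost b" by simp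
      ultimately show ?thesis
        unfolding run_def using less.prems False by blast
    qed
  qed
  from this[of 0 s] assms(1) show ?thesis by simp
qed

section \<open>Frames: what a program cannot change\<close>

fun nwr :: "com \<Rightarrow> nat set" where
  "nwr Skip = {}"
| "nwr (NStore g a e) = {g}"
| "nwr (RStore g a e) = {}"
| "nwr (Flip g a) = {g}"
| "nwr (Seq c1 c2) = nwr c1 \<union> nwr c2"
| "nwr (If b c1 c2) = nwr c1 \<union> nwr c2"
| "nwr (While b c) = nwr c"

fun rwr :: "com \<Rightarrow> nat set" where
  "rwr Skip = {}"
| "rwr (NStore g a e) = {}"
| "rwr (RStore g a e) = {g}"
| "rwr (Flip g a) = {}"
| "rwr (Seq c1 c2) = rwr c1 \<union> rwr c2"
| "rwr (If b c1 c2) = rwr c1 \<union> rwr c2"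
| "rwr (While b c) = rwr c"

fun flips :: "com \<Rightarrow> bool" where
  "flips (Flip g a) = True"
| "flips (Seq c1 c2) = (flips c1 \<or> flips c2)"
| "flips (If b c1 c2) = (flips c1 \<or> flips c2)"
| "flips (While b c) = flips c"
| "flips _ = False"

text \<open>Works with whole segments, since the program text fixes the segment of each write. Loop
  invariants then mention only what a loop changes.\<close>

definition frame :: "com \<Rightarrow> state \<Rightarrow> state \<Rightarrow> bool" where
  "frame c s s' \<longleftrightarrow> (\<forall>g. g \<notin> nwr c \<longrightarrow> nmem s' g = nmem s g) \<and>
    (\<forall>g. g \<notin> rwr c \<longrightarrow> rmem s' g = rmem s g) \<and> (flips c \<or> coins s' = coins s)"

lemma exec_frame: "exec c s t s' \<Longrightarrow> frame c s s'"
  by (induction rule: exec.induct) (auto simp: frame_def)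

lemma run_frame: "run c s T Q \<Longrightarrow> run c s T (\<lambda>s'. Q s' \<and> frame c s s')"
  unfolding run_def using exec_frame by blast

lemma run_frame_mono:
  "run c s T Q \<Longrightarrow> T \<le> T' \<Longrightarrow> (\<And>s'. Q s' \<Longrightarrow> frame c s s' \<Longrightarrow> Q' s') \<Longrightarrow> run c s T' Q'"
  using run_mono[OF run_frame] by blast

lemma run_Seq_frame:
  assumes "run c1 s T1 R" and "\<And>s'. R s' \<Longrightarrow> frame c1 s s' \<Longrightarrow> run c2 s' T2 Q"
  shows "run (Seq c1 c2) s (T1 + T2) Q"
  using run_Seq[OF run_frame[OF assms(1)]] assms(2) by blast

section \<open>Loop-free code by symbolic evaluation, and counting loops\<close>

fun flat :: "com \<Rightarrow> bool" where
  "flat (Seq c1 c2) = (flat c1 \<and> flat c2)"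
| "flat (If b c1 c2) = (flat c1 \<and> flat c2)"
| "flat (While b c) = False"
| "flat _ = True"

fun post :: "com \<Rightarrow> state \<Rightarrow> state" where
  "post Skip s = s"
| "post (NStore g a e) s = s\<lparr>nmem := (nmem s)(g := (nmem s g)(nval a s := nval e s))\<rparr>"
| "post (RStore g a e) s = s\<lparr>rmem := (rmem s)(g := (rmem s g)(nval a s := rval e s))\<rparr>"
| "post (Flip g a) s = s\<lparr>nmem := (nmem s)(g := (nmem s g)(nval a s := of_bool (coins s 0))),
     coins := (\<lambda>i. coins s (Suc i))\<rparr>"
| "post (Seq c1 c2) s = post c2 (post c1 s)"
| "post (If b c1 c2) s = (if bval b s then post c1 s else post c2 s)"
| "post (While b c) s = s"

text \<open>A conditional is charged for both branches, which bounds either one without a maximum.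
  The value for \<open>While\<close> is a dummy, excluded by \<open>flat\<close>.\<close>

fun wcost :: "com \<Rightarrow> nat" where
  "wcost Skip = 1"
| "wcost (NStore g a e) = 1 + ncost a + ncost e"
| "wcost (RStore g a e) = 1 + ncost a + rcost e"
| "wcost (Flip g a) = 1 + ncost a"
| "wcost (Seq c1 c2) = wcost c1 + wcost c2"
| "wcost (If b c1 c2) = 1 + bcost b + wcost c1 + wcost c2"
| "wcost (While b c) = 0"

lemma run_flat: "flat c \<Longrightarrow> run c s (wcost c) (\<lambda>s'. s' = post c s)"
proof (induction c arbitrary: s)
  case (Seq c1 c2)
  then have "run (Seq c1 c2) s (wcost c1 + wcost c2) (\<lambda>s'. s' = post c2 (post c1 s))"
    by (intro run_Seq[where R = "\<lambda>s'. s' = post c1 s"]) auto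
  then show ?case by simp
next
  case (If b c1 c2)
  show ?case
  proof (cases "bval b s")
    case True
    with If(1)[of s] If.prems show ?thesis
      unfolding run_def by (fastforce intro: exec.IfTrue)
  next
    case False
    with If(2)[of s] If.prems show ?thesis
      unfolding run_def by (fastforce intro: exec.IfFalse)
  qed
next
  case (Flip g a)
  show ?case using exec.Flip[of g a s] by (auto simp: run_def)
qed (use exec.Skip exec.NStore exec.RStore in \<open>fastforce simp: run_def\<close>)+

lemma run_flatI: "flat c \<Longrightarrow> wcost c \<le> T \<Longrightarrow> Q (post c s) \<Longrightarrow> run c s T Q"
  by (rule run_mono[OF run_flat]) auto

abbreviation nvar :: "nat \<Rightarrow> nexp" where
  "nvar g \<equiv> NLoad g (NConst 0)"

abbreviation rvar :: "nat \<Rightarrow> rexp" where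
  "rvar g \<equiv> RLoad g (NConst 0)"

definition For :: "nat \<Rightarrow> nexp \<Rightarrow> com \<Rightarrow> com" where
  "For g e c = Seq (NStore g (NConst 0) (NConst 0))
    (While (NLess (nvar g) e) (Seq c (NStore g (NConst 0) (NAdd (nvar g) (NConst 1)))))"

lemma nwr_For [simp]: "nwr (For g e c) = insert g (nwr c)"
  and rwr_For [simp]: "rwr (For g e c) = rwr c"
  and flips_For [simp]: "flips (For g e c) = flips c"
  by (auto simp: For_def)

definition set_counter :: "nat \<Rightarrow> nat \<Rightarrow> state \<Rightarrow> state" where
  "set_counter g v s = s\<lparr>nmem := (nmem s)(g := (nmem s g)(0 := v))\<rparr>"

lemma set_counter_simps [simp]:
  "nmem (set_counter g v s) = (nmem s)(g := (nmem s g)(0 := v))"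
  "rmem (set_counter g v s) = rmem s"
  "coins (set_counter g v s) = coins s"
  by (simp_all add: set_counter_def)

text \<open>The loop bound \<open>e\<close> is re-evaluated at each test, so it must be stable under
  everything the loop may write. The 10 per iteration pays for test and increment, the 7 for
  initialisation and the final test, each besides evaluating \<open>e\<close>.\<close>

lemma run_For:
  assumes counter: "g \<notin> nwr c"
    and bound: "\<And>s'. frame (For g e c) s s' \<Longrightarrow> nval e s' = N"
    and init: "I 0 (set_counter g 0 s)"
    and step: "\<And>j s'. j < N \<Longrightarrow> I j s' \<Longrightarrow> nmem s' g 0 = j \<Longrightarrow> frame (For g e c) s s' \<Longrightarrow>
      run c s' T (\<lambda>s''. I (Suc j) (set_counter g (Suc j) s''))"
  shows "run (For g e c) s (N * (T + ncost e + 10) + 7 + ncost e) (I N)"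
proof -
  let ?b = "NLess (nvar g) e"
  let ?inc = "NStore g (NConst 0) (NAdd (nvar g) (NConst 1))"
  define J where "J j s' \<longleftrightarrow> I j s' \<and> nmem s' g 0 = j \<and> j \<le> N \<and> frame (For g e c) s s'" for j s'
  have "run (While ?b (Seq c ?inc)) (set_counter g 0 s)
      (N * (1 + bcost ?b + (T + wcost ?inc)) + 1 + bcost ?b) (\<lambda>s'. \<exists>m. J m s' \<and> \<not> bval ?b s')"
  proof (rule run_While)
    show "J 0 (set_counter g 0 s)"
      using init by (simp add: J_def frame_def)
  next
    fix j s' assume J: "J j s'" and b: "bval ?b s'"
    have j: "j < N" using J b bound[of s'] by (simp add: J_def)
    have "run (Seq c ?inc) s' (T + wcost ?inc) (J (Suc j))"
    proof (rule run_Seq_frame)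
      show "run c s' T (\<lambda>s''. I (Suc j) (set_counter g (Suc j) s''))"
        using J j step by (simp add: J_def)
      fix s'' assume I: "I (Suc j) (set_counter g (Suc j) s'')" and fr: "frame c s' s''"
      have g: "nmem s'' g 0 = j" using fr counter J by (simp add: frame_def J_def)
      have "frame (For g e c) s s''"
        using J fr by (auto simp: J_def frame_def)
      then have "frame (For g e c) s (set_counter g (Suc j) s'')"
        by (simp add: frame_def)
      then show "run ?inc s'' (wcost ?inc) (J (Suc j))"
        using I g j by (intro run_flatI) (simp_all add: J_def set_counter_def)
    qed
    with j show "j < N \<and> run (Seq c ?inc) s' (T + wcost ?inc) (J (Suc j))" by blast
  qed
  then have "run (For g e c) s (3 + (N * (1 + bcost ?b + (T + wcost ?inc)) + 1 + bcost ?b))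
      (\<lambda>s'. \<exists>m. J m s' \<and> \<not> bval ?b s')"
    unfolding For_def
    by (intro run_Seq[where R = "\<lambda>s'. s' = set_counter g 0 s"])
      (auto intro!: run_flatI simp: set_counter_def)
  then show ?thesis
  proof (rule run_mono)
    fix s' assume "\<exists>m. J m s' \<and> \<not> bval ?b s'"
    then obtain m where m: "J m s'" "\<not> bval ?b s'" by blast
    then have "m = N" using bound[of s'] by (auto simp: J_def)
    with m show "I N s'" by (simp add: J_def)
  qed (simp add: algebra_simps)
qed

section \<open>The clustering program\<close>

text \<open>
  Memory layout. Natural-number segments: 1 the labels, 2 \<open>\<lceil>log\<^sub>2 n\<rceil>\<close>, 3 a power of 2, 4 the
  sketch dimension \<open>k\<close>, 5--7 loop counters, 8 a random bit, 9 the round, 10 the current farthest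
  point. Real segments: 2 the output, 3 the sign matrix, 4 the sketches, 5 the squared sketched
  distances to the nearest center, 6 an accumulator.
\<close>

lemma row_index_less:
  assumes "r < k" and "i < (d::nat)"
  shows "r * d + i < k * d"
proof -
  have "r * d + i < Suc r * d" using assms(2) by simp
  also have "\<dots> \<le> k * d" using assms(1) by (intro mult_le_mono1) simp
  finally show ?thesis .
qed

abbreviation "in_n \<equiv> NLoad 0 (NConst 0)"
abbreviation "in_d \<equiv> NLoad 0 (NConst 1)"
abbreviation "in_l \<equiv> NLoad 0 (NConst 2)"

abbreviation row :: "nexp \<Rightarrow> nexp \<Rightarrow> nexp \<Rightarrow> nexp" where
  "row a w b \<equiv> NAdd (NMult a w) b"

section \<open>Computing the sketch dimension\<close>

definition log_prog :: com where
  "log_prog = Seq (NStore 3 (NConst 0) (NConst 1))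
    (While (NLess (nvar 3) in_n)
      (Seq (NStore 3 (NConst 0) (NMult (NConst 2) (nvar 3)))
           (NStore 2 (NConst 0) (NAdd (nvar 2) (NConst 1)))))"

definition log_ceil :: "nat \<Rightarrow> nat" where
  "log_ceil n = (LEAST L. n \<le> 2 ^ L)"

lemma log_ceil_eqI:
  assumes "n \<le> 2 ^ L" and "L = 0 \<or> 2 ^ (L - 1) < n"
  shows "log_ceil n = L"
  unfolding log_ceil_def
proof (rule Least_equality)
  fix M :: nat assume M: "n \<le> 2 ^ M"
  show "L \<le> M"
  proof (rule ccontr)
    assume "\<not> L \<le> M"
    then have "(2::nat) ^ M \<le> 2 ^ (L - 1)" by (intro power_increasing) auto
    with M have "n \<le> 2 ^ (L - 1)" by (rule order_trans)
    with assms(2) \<open>\<not> L \<le> M\<close> show False by (simp add: leD)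
  qed
qed (fact assms(1))

lemma log_ceil:
  shows log_ceil_ge: "n \<le> 2 ^ log_ceil n"
    and log_ceil_minimal: "log_ceil n = 0 \<or> 2 ^ (log_ceil n - 1) < n"
proof -
  show "n \<le> 2 ^ log_ceil n"
    unfolding log_ceil_def by (rule LeastI[where k = n]) (simp add: less_imp_le)
  show "log_ceil n = 0 \<or> 2 ^ (log_ceil n - 1) < n"
  proof (cases "log_ceil n")
    case (Suc m)
    then have "\<not> n \<le> 2 ^ m" unfolding log_ceil_def by (intro not_less_Least) simp
    with Suc show ?thesis by simp
  qed simp
qed

text \<open>The loop test gives \<open>2 ^ m < n\<close>, hence \<open>m < n\<close>; this crude
  iteration bound suffices because linear time is within the budget.\<close>

lemma run_log:
  assumes "nmem s 0 0 = n" and "nmem s 2 0 = 0"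
  shows "run log_prog s (18 * n + 9) (\<lambda>s'. nmem s' 2 0 = log_ceil n)"
proof -
  let ?b = "NLess (nvar 3) in_n"
  let ?c = "Seq (NStore 3 (NConst 0) (NMult (NConst 2) (nvar 3)))
    (NStore 2 (NConst 0) (NAdd (nvar 2) (NConst 1)))"
  let ?I = "\<lambda>m s'. nmem s' 0 0 = n \<and> nmem s' 3 0 = 2 ^ m \<and> nmem s' 2 0 = m \<and>
    (m = 0 \<or> 2 ^ (m - 1) < n)"
  have "run (While ?b ?c) s' (n * (1 + bcost ?b + wcost ?c) + 1 + bcost ?b)
      (\<lambda>s'. \<exists>m. ?I m s' \<and> \<not> bval ?b s')" if "?I 0 s'" for s'
  proof (rule run_While)
    fix m s' assume "?I m s'" "bval ?b s'"
    then have "m < n" and "run ?c s' (wcost ?c) (?I (Suc m))"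
      using less_exp[of m] by (auto intro!: run_flatI simp del: less_exp)
    then show "m < n \<and> run ?c s' (wcost ?c) (?I (Suc m))" by blast
  qed (use that in blast)
  then have "run log_prog s (3 + (n * (1 + bcost ?b + wcost ?c) + 1 + bcost ?b))
      (\<lambda>s'. \<exists>m. ?I m s' \<and> \<not> bval ?b s')"
    unfolding log_prog_def
    by (rule run_Seq[where R = "?I 0", rotated]) (use assms in \<open>auto intro!: run_flatI\<close>)
  then show ?thesis
  proof (rule run_mono)
    fix s' assume "\<exists>m. ?I m s' \<and> \<not> bval ?b s'"
    then obtain m where m: "?I m s'" "\<not> bval ?b s'" by blast
    then have "log_ceil n = m" by (intro log_ceil_eqI) auto
    with m(1) show "nmem s' 2 0 = log_ceil n" by simp
  qed simp
qed

text \<open>The ceiling of \<open>B * log_ceil n / \<epsilon>^2\<close> for positive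
  \<open>\<epsilon>\<close>, multiplied out into a comparison that the machine can test.\<close>

definition sketch_dim :: "nat \<Rightarrow> nat \<Rightarrow> real \<Rightarrow> nat" where
  "sketch_dim B n \<epsilon> = (LEAST k. real (B * log_ceil n) \<le> real k * \<epsilon>\<^sup>2)"

lemma sketch_dim:
  assumes "0 < \<epsilon>"
  shows sketch_dim_ge: "real (B * log_ceil n) \<le> real (sketch_dim B n \<epsilon>) * \<epsilon>\<^sup>2"
    and sketch_dim_minimal: "m < sketch_dim B n \<epsilon> \<Longrightarrow> real m * \<epsilon>\<^sup>2 < real (B * log_ceil n)"
proof -
  obtain k where "real (B * log_ceil n) / \<epsilon>\<^sup>2 \<le> real k" using real_arch_simple by blast
  then have "real (B * log_ceil n) \<le> real k * \<epsilon>\<^sup>2" using assms by (simp add: field_simps)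
  then show "real (B * log_ceil n) \<le> real (sketch_dim B n \<epsilon>) * \<epsilon>\<^sup>2"
    unfolding sketch_dim_def by (rule LeastI)
  show "real m * \<epsilon>\<^sup>2 < real (B * log_ceil n)" if "m < sketch_dim B n \<epsilon>"
    using not_less_Least[OF that[unfolded sketch_dim_def]] by simp
qed

text \<open>Linear search replaces rounding, which the machine does not offer; its cost is
  proportional to the dimension found.\<close>

definition dim_prog :: "nat \<Rightarrow> com" where
  "dim_prog B = While
    (RLess (RMult (ROfNat (nvar 4)) (RMult (rvar 0) (rvar 0))) (ROfNat (NMult (NConst B) (nvar 2))))
    (NStore 4 (NConst 0) (NAdd (nvar 4) (NConst 1)))"

lemma run_dim:
  assumes \<epsilon>: "0 < \<epsilon>" and s: "rmem s 0 0 = \<epsilon>" "nmem s 2 0 = log_ceil n" "nmem s 4 0 = 0"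
  shows "run (dim_prog B) s (22 * sketch_dim B n \<epsilon> + 16) (\<lambda>s'. nmem s' 4 0 = sketch_dim B n \<epsilon>)"
proof -
  define k where "k = sketch_dim B n \<epsilon>"
  let ?b = "RLess (RMult (ROfNat (nvar 4)) (RMult (rvar 0) (rvar 0)))
    (ROfNat (NMult (NConst B) (nvar 2)))"
  let ?c = "NStore 4 (NConst 0) (NAdd (nvar 4) (NConst 1))"
  let ?I = "\<lambda>m s'. rmem s' 0 0 = \<epsilon> \<and> nmem s' 2 0 = log_ceil n \<and> nmem s' 4 0 = m \<and> m \<le> k"
  have b: "bval ?b s' \<longleftrightarrow> m < k" if "?I m s'" for m s'
  proof -
    have "bval ?b s' \<longleftrightarrow> real m * \<epsilon>\<^sup>2 < real (B * log_ceil n)"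
      using that by (simp add: power2_eq_square)
    also have "\<dots> \<longleftrightarrow> m < k"
    proof
      assume "real m * \<epsilon>\<^sup>2 < real (B * log_ceil n)"
      also have "\<dots> \<le> real k * \<epsilon>\<^sup>2" unfolding k_def by (rule sketch_dim_ge[OF \<epsilon>])
      finally show "m < k" using \<epsilon> by simp
    qed (use sketch_dim_minimal[OF \<epsilon>] in \<open>simp add: k_def\<close>)
    finally show ?thesis .
  qed
  have "run (While ?b ?c) s (k * (1 + bcost ?b + wcost ?c) + 1 + bcost ?b)
      (\<lambda>s'. \<exists>m. ?I m s' \<and> \<not> bval ?b s')"
  proof (rule run_While[where I = ?I])
    fix m s' assume I: "?I m s'" and "bval ?b s'"
    then have "m < k" using b by blast
    then show "m < k \<and> run ?c s' (wcost ?c) (?I (Suc m))"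
      using I by (auto intro!: run_flatI)
  qed (use s in simp)
  then show ?thesis
    unfolding dim_prog_def k_def[symmetric]
  proof (rule run_mono)
    fix s' assume "\<exists>m. ?I m s' \<and> \<not> bval ?b s'"
    then obtain m where m: "?I m s'" "\<not> bval ?b s'" by blast
    then have "m = k" using b by fastforce
    with m(1) show "nmem s' 4 0 = k" by simp
  qed simp
qed

section \<open>Drawing the signs and sketching the points\<close>

definition signs_prog :: com where
  "signs_prog = For 7 (NMult (nvar 4) in_d)
    (Seq (Flip 8 (NConst 0))
      (RStore 3 (nvar 7) (RSub (RMult (ROfNat (NConst 2)) (ROfNat (nvar 8))) (ROfNat (NConst 1)))))"

lemma run_signs:
  assumes "nmem s 0 1 = d" and "nmem s 4 0 = k" and "coins s = \<omega>"
  shows "run signs_prog s (29 * (k * d) + 12) (\<lambda>s'. \<forall>a<k * d. rmem s' 3 a = sgn_of (\<omega> a))"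
proof -
  let ?I = "\<lambda>j s'. (\<forall>a<j. rmem s' 3 a = sgn_of (\<omega> a)) \<and> coins s' = (\<lambda>i. \<omega> (j + i))"
  have "run signs_prog s (k * d * (14 + ncost (NMult (nvar 4) in_d) + 10) + 7
      + ncost (NMult (nvar 4) in_d)) (?I (k * d))"
    unfolding signs_prog_def
  proof (rule run_For[where I = "?I"])
    fix j and s' :: state assume "?I j s'" and "nmem s' 7 0 = j"
    then show "run (Seq (Flip 8 (NConst 0)) (RStore 3 (nvar 7)
        (RSub (RMult (ROfNat (NConst 2)) (ROfNat (nvar 8))) (ROfNat (NConst 1))))) s' 14
        (\<lambda>s''. ?I (Suc j) (set_counter 7 (Suc j) s''))"
      by (intro run_flatI) (auto simp: less_Suc_eq sgn_of_def)
  qed (use assms in \<open>auto simp: frame_def\<close>)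
  then show ?thesis by (rule run_mono) auto
qed

definition dot_prog :: com where
  "dot_prog = Seq (RStore 6 (NConst 0) (ROfNat (NConst 0)))
    (For 7 in_d (RStore 6 (NConst 0) (RAdd (rvar 6)
      (RMult (RLoad 3 (row (nvar 5) in_d (nvar 7))) (RLoad 1 (row (nvar 6) in_d (nvar 7)))))))"

lemma run_dot:
  assumes d: "nmem s 0 1 = d"
  shows "run dot_prog s (36 * d + 13) (\<lambda>s'. rmem s' 6 0 =
    (\<Sum>q<d. rmem s 3 (nmem s 5 0 * d + q) * rmem s 1 (nmem s 6 0 * d + q)))"
proof -
  let ?c = "RStore 6 (NConst 0) (RAdd (rvar 6)
      (RMult (RLoad 3 (row (nvar 5) in_d (nvar 7))) (RLoad 1 (row (nvar 6) in_d (nvar 7)))))"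
  let ?I = "\<lambda>j s'. rmem s' 6 0 =
    (\<Sum>q<j. rmem s 3 (nmem s 5 0 * d + q) * rmem s 1 (nmem s 6 0 * d + q))"
  have "run dot_prog s (4 + (d * (wcost ?c + ncost in_d + 10) + 7 + ncost in_d)) (?I d)"
    unfolding dot_prog_def
  proof (rule run_Seq_frame)
    show "run (RStore 6 (NConst 0) (ROfNat (NConst 0))) s 4 (\<lambda>s'. rmem s' 6 0 = 0)"
      by (rule run_flatI) auto
    fix s1 assume s1: "rmem s1 6 0 = 0" and fr: "frame (RStore 6 (NConst 0) (ROfNat (NConst 0))) s s1"
    show "run (For 7 in_d ?c) s1 (d * (wcost ?c + ncost in_d + 10) + 7 + ncost in_d) (?I d)"
    proof (rule run_For[where I = "?I"])
      fix j s' assume "j < d" "?I j s'" "nmem s' 7 0 = j" "frame (For 7 in_d ?c) s1 s'"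
      then show "run ?c s' (wcost ?c) (\<lambda>s''. ?I (Suc j) (set_counter 7 (Suc j) s''))"
        using fr d by (intro run_flatI) (simp_all add: frame_def)
    qed (use s1 fr d in \<open>auto simp: frame_def\<close>)
  qed
  then show ?thesis by (rule run_mono) auto
qed

definition sketch_prog :: com where
  "sketch_prog = For 6 in_n (For 5 (nvar 4)
    (Seq dot_prog (RStore 4 (row (nvar 6) (nvar 4) (nvar 5)) (rvar 6))))"

lemma nwr_dot [simp]: "nwr dot_prog = {7}"
  and rwr_dot [simp]: "rwr dot_prog = {6}"
  and flips_dot [simp]: "\<not> flips dot_prog"
  by (simp_all add: dot_prog_def)

text \<open>Cell \<open>i * k + r\<close> holds coordinate \<open>r\<close> of the sketch of point
  \<open>i\<close>. Both invariants count finished cells linearly, so the end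
  \<open>i * k + k\<close> of the inner loop is the next start of the outer one.\<close>

lemma run_sketch:
  assumes n: "nmem s 0 0 = n" and d: "nmem s 0 1 = d" and k: "nmem s 4 0 = k"
    and pts: "\<And>a. a < n * d \<Longrightarrow> rmem s 1 a = p (a div d) (a mod d)"
    and signs: "\<And>a. a < k * d \<Longrightarrow> rmem s 3 a = sgn_of (\<omega> a)"
  shows "run sketch_prog s (n * (k * (36 * d + 36) + 21) + 9)
    (\<lambda>s'. \<forall>a<n * k. rmem s' 4 a = rademacher d (p (a div k)) (\<lambda>q. \<omega> (a mod k * d + q)))"
proof -
  let ?Y = "\<lambda>a. rademacher d (p (a div k)) (\<lambda>q. \<omega> (a mod k * d + q))"
  let ?I = "\<lambda>j s'. \<forall>a<j. rmem s' 4 a = ?Y a"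
  let ?store = "RStore 4 (row (nvar 6) (nvar 4) (nvar 5)) (rvar 6)"
  let ?inner = "For 5 (nvar 4) (Seq dot_prog ?store)"
  have "run sketch_prog s (n * (k * (36 * d + 36) + 9 + ncost in_n + 10) + 7 + ncost in_n) (?I (n * k))"
    unfolding sketch_prog_def
  proof (rule run_For[where I = "\<lambda>i. ?I (i * k)"])
    fix i s1 assume i: "i < n" "nmem s1 6 0 = i" and I: "?I (i * k) s1"
      and fr: "frame (For 6 in_n ?inner) s s1"
    have "run ?inner s1 (k * (36 * d + 24 + ncost (nvar 4) + 10) + 7 + ncost (nvar 4)) (?I (i * k + k))"
    proof (rule run_For[where I = "\<lambda>r. ?I (i * k + r)"])
      fix r s2 assume r: "r < k" "nmem s2 5 0 = r" and I: "?I (i * k + r) s2"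
        and fr2: "frame ?inner s1 s2"
      have env: "nmem s2 0 = nmem s 0" "nmem s2 4 = nmem s 4" "nmem s2 6 0 = i"
        "rmem s2 1 = rmem s 1" "rmem s2 3 = rmem s 3"
        using fr fr2 i by (simp_all add: frame_def)
      have "run (Seq dot_prog ?store) s2 (36 * d + 13 + 11) (?I (i * k + Suc r))"
      proof (rule run_Seq_frame[OF run_dot])
        show "nmem s2 0 1 = d" using env d by simp
        fix s3 assume dot: "rmem s3 6 0 = (\<Sum>q<d. rmem s2 3 (nmem s2 5 0 * d + q) *
            rmem s2 1 (nmem s2 6 0 * d + q))" and fr3: "frame dot_prog s2 s3"
        have "(\<Sum>q<d. rmem s2 3 (nmem s2 5 0 * d + q) * rmem s2 1 (nmem s2 6 0 * d + q)) =
            ?Y (i * k + r)"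
          unfolding rademacher_def
        proof (rule sum.cong)
          fix q assume "q \<in> {..<d}"
          then have q: "q < d" by simp
          have "r * d + q < k * d" "i * d + q < n * d"
            using q r(1) i(1) by (simp_all add: row_index_less)
          then show "rmem s2 3 (nmem s2 5 0 * d + q) * rmem s2 1 (nmem s2 6 0 * d + q) =
              sgn_of (\<omega> ((i * k + r) mod k * d + q)) * p ((i * k + r) div k) q"
            using q r by (simp add: env pts signs del: One_nat_def)
        qed simp
        with dot have "rmem s3 6 0 = ?Y (i * k + r)" by simp
        then show "run ?store s3 11 (?I (i * k + Suc r))"
          using fr3 env r I k by (intro run_flatI) (auto simp: frame_def less_Suc_eq)
      qed
      then show "run (Seq dot_prog ?store) s2 (36 * d + 24)
          (\<lambda>s'. ?I (i * k + Suc r) (set_counter 5 (Suc r) s'))"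
        by (rule run_mono) auto
    qed (use I fr k in \<open>auto simp: frame_def\<close>)
    then show "run ?inner s1 (k * (36 * d + 36) + 9) (\<lambda>s'. ?I (Suc i * k) (set_counter 6 (Suc i) s'))"
      by (rule run_mono) (auto simp: add.commute)
  qed (use n in \<open>auto simp: frame_def\<close>)
  then show ?thesis by (rule run_mono) auto
qed

section \<open>One round of the traversal\<close>

definition choose_prog :: com where
  "choose_prog = Seq (NStore 10 (NConst 0) (NConst 0))
    (For 6 in_n (If (RLess (RLoad 5 (nvar 10)) (RLoad 5 (nvar 6)))
      (NStore 10 (NConst 0) (nvar 6)) Skip))"

lemma run_choose:
  assumes n: "nmem s 0 0 = n" "0 < n"
  shows "run choose_prog s (26 * n + 12)
    (\<lambda>s'. nmem s' 10 0 < n \<and> (\<forall>i<n. rmem s 5 i \<le> rmem s 5 (nmem s' 10 0)))"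
proof -
  let ?c = "If (RLess (RLoad 5 (nvar 10)) (RLoad 5 (nvar 6))) (NStore 10 (NConst 0) (nvar 6)) Skip"
  let ?I = "\<lambda>j s'. nmem s' 10 0 < n \<and> (\<forall>i<j. rmem s 5 i \<le> rmem s 5 (nmem s' 10 0))"
  have "run choose_prog s (3 + (n * (wcost ?c + ncost in_n + 10) + 7 + ncost in_n)) (?I n)"
    unfolding choose_prog_def
  proof (rule run_Seq_frame)
    show "run (NStore 10 (NConst 0) (NConst 0)) s 3 (\<lambda>s'. nmem s' 10 0 = 0)"
      by (rule run_flatI) auto
    fix s1 assume s1: "nmem s1 10 0 = 0" and fr: "frame (NStore 10 (NConst 0) (NConst 0)) s s1"
    show "run (For 6 in_n ?c) s1 (n * (wcost ?c + ncost in_n + 10) + 7 + ncost in_n) (?I n)"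
    proof (rule run_For[where I = "?I"])
      fix j s' assume "j < n" "?I j s'" "nmem s' 6 0 = j" "frame (For 6 in_n ?c) s1 s'"
      then show "run ?c s' (wcost ?c) (\<lambda>s''. ?I (Suc j) (set_counter 6 (Suc j) s''))"
        using fr by (intro run_flatI) (auto simp: frame_def less_Suc_eq)
    qed (use s1 fr n in \<open>auto simp: frame_def\<close>)
  qed
  then show ?thesis by (rule run_mono) auto
qed

definition dist_prog :: com where
  "dist_prog = Seq (RStore 6 (NConst 0) (ROfNat (NConst 0)))
    (For 5 (nvar 4) (RStore 6 (NConst 0) (RAdd (rvar 6) (RMult
      (RSub (RLoad 4 (row (nvar 6) (nvar 4) (nvar 5))) (RLoad 4 (row (nvar 10) (nvar 4) (nvar 5))))
      (RSub (RLoad 4 (row (nvar 6) (nvar 4) (nvar 5))) (RLoad 4 (row (nvar 10) (nvar 4) (nvar 5))))))))"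

lemma nwr_dist [simp]: "nwr dist_prog = {5}"
  and rwr_dist [simp]: "rwr dist_prog = {6}"
  and flips_dist [simp]: "\<not> flips dist_prog"
  by (simp_all add: dist_prog_def)

lemma run_dist:
  assumes k: "nmem s 4 0 = k"
  shows "run dist_prog s (56 * k + 13) (\<lambda>s'. rmem s' 6 0 =
    (\<Sum>r<k. (rmem s 4 (nmem s 6 0 * k + r) - rmem s 4 (nmem s 10 0 * k + r))\<^sup>2))"
proof -
  let ?diff = "RSub (RLoad 4 (row (nvar 6) (nvar 4) (nvar 5))) (RLoad 4 (row (nvar 10) (nvar 4) (nvar 5)))"
  let ?c = "RStore 6 (NConst 0) (RAdd (rvar 6) (RMult ?diff ?diff))"
  let ?I = "\<lambda>j s'. rmem s' 6 0 =
    (\<Sum>r<j. (rmem s 4 (nmem s 6 0 * k + r) - rmem s 4 (nmem s 10 0 * k + r))\<^sup>2)"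
  have "run dist_prog s (4 + (k * (wcost ?c + ncost (nvar 4) + 10) + 7 + ncost (nvar 4))) (?I k)"
    unfolding dist_prog_def
  proof (rule run_Seq_frame)
    show "run (RStore 6 (NConst 0) (ROfNat (NConst 0))) s 4 (\<lambda>s'. rmem s' 6 0 = 0)"
      by (rule run_flatI) auto
    fix s1 assume s1: "rmem s1 6 0 = 0" and fr: "frame (RStore 6 (NConst 0) (ROfNat (NConst 0))) s s1"
    show "run (For 5 (nvar 4) ?c) s1 (k * (wcost ?c + ncost (nvar 4) + 10) + 7 + ncost (nvar 4)) (?I k)"
    proof (rule run_For[where I = "?I"])
      fix j s' assume "j < k" "?I j s'" "nmem s' 5 0 = j" "frame (For 5 (nvar 4) ?c) s1 s'"
      then show "run ?c s' (wcost ?c) (\<lambda>s''. ?I (Suc j) (set_counter 5 (Suc j) s''))"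
        using fr k by (intro run_flatI) (simp_all add: frame_def power2_eq_square)
    qed (use s1 fr k in \<open>auto simp: frame_def\<close>)
  qed
  then show ?thesis by (rule run_mono) auto
qed

text \<open>By De Morgan, the guard says that this is round 0 or the new center is strictly
  closer.\<close>

definition update_prog :: com where
  "update_prog = For 6 in_n (Seq dist_prog
    (If (BNot (BAnd (BNot (NLess (nvar 9) (NConst 1))) (BNot (RLess (rvar 6) (RLoad 5 (nvar 6))))))
      (Seq (RStore 5 (nvar 6) (rvar 6)) (NStore 1 (nvar 6) (nvar 9))) Skip))"

lemma run_update:
  assumes n: "nmem s 0 0 = n" and k: "nmem s 4 0 = k"
    and \<Delta>: "\<And>i. i < n \<Longrightarrow>
      (\<Sum>r<k. (rmem s 4 (i * k + r) - rmem s 4 (nmem s 10 0 * k + r))\<^sup>2) = \<Delta> i"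
  shows "run update_prog s (n * (56 * k + 57) + 9) (\<lambda>s'. \<forall>i<n.
    rmem s' 5 i = (if nmem s 9 0 = 0 \<or> \<Delta> i < rmem s 5 i then \<Delta> i else rmem s 5 i) \<and>
    nmem s' 1 i = (if nmem s 9 0 = 0 \<or> \<Delta> i < rmem s 5 i then nmem s 9 0 else nmem s 1 i))"
proof -
  let ?upd = "\<lambda>i. nmem s 9 0 = 0 \<or> \<Delta> i < rmem s 5 i"
  \<comment> \<open>Cells not yet visited are recorded with their old values, so iteration
    \<open>i\<close> still compares with the entry from before the loop.\<close>
  let ?I = "\<lambda>j s'. \<forall>i. rmem s' 5 i = (if i < j \<and> ?upd i then \<Delta> i else rmem s 5 i) \<and>
    nmem s' 1 i = (if i < j \<and> ?upd i then nmem s 9 0 else nmem s 1 i)"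
  let ?store = "If (BNot (BAnd (BNot (NLess (nvar 9) (NConst 1)))
      (BNot (RLess (rvar 6) (RLoad 5 (nvar 6))))))
    (Seq (RStore 5 (nvar 6) (rvar 6)) (NStore 1 (nvar 6) (nvar 9))) Skip"
  have "run update_prog s (n * (56 * k + 13 + wcost ?store + ncost in_n + 10) + 7 + ncost in_n) (?I n)"
    unfolding update_prog_def
  proof (rule run_For[where I = "?I"])
    fix i s1 assume i: "i < n" "nmem s1 6 0 = i" and I: "?I i s1"
      and fr: "frame (For 6 in_n (Seq dist_prog ?store)) s s1"
    have env: "nmem s1 4 = nmem s 4" "nmem s1 9 = nmem s 9" "nmem s1 10 = nmem s 10"
      "rmem s1 4 = rmem s 4"
      using fr by (simp_all add: frame_def)
    show "run (Seq dist_prog ?store) s1 (56 * k + 13 + wcost ?store)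
        (\<lambda>s'. ?I (Suc i) (set_counter 6 (Suc i) s'))"
    proof (rule run_Seq_frame[OF run_dist])
      show "nmem s1 4 0 = k" using env k by simp
      fix s2 assume "rmem s2 6 0 = (\<Sum>r<k. (rmem s1 4 (nmem s1 6 0 * k + r) -
          rmem s1 4 (nmem s1 10 0 * k + r))\<^sup>2)" and fr2: "frame dist_prog s1 s2"
      then have dist: "rmem s2 6 0 = \<Delta> i" using i env by (simp add: \<Delta>)
      have env2: "nmem s2 6 0 = i" "nmem s2 9 = nmem s 9" "nmem s2 1 = nmem s1 1" "rmem s2 5 = rmem s1 5"
        using fr2 i env by (simp_all add: frame_def)
      have old: "rmem s1 5 i = rmem s 5 i" using I by simp
      show "run ?store s2 (wcost ?store) (\<lambda>s'. ?I (Suc i) (set_counter 6 (Suc i) s'))"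
        using I by (intro run_flatI) (auto simp: dist env2 old less_Suc_eq simp del: One_nat_def)
    qed
  qed (use n in \<open>auto simp: frame_def\<close>)
  then show ?thesis by (rule run_mono) auto
qed

text \<open>Runs after the update, which may have overwritten the new center's own entry by its
  distance 0 to itself.\<close>

definition mark_prog :: com where
  "mark_prog = Seq (RStore 5 (nvar 10) (RSub (ROfNat (NConst 0)) (ROfNat (NConst 1))))
    (NStore 1 (nvar 10) (nvar 9))"

definition emit_prog :: com where
  "emit_prog = For 7 in_d
    (RStore 2 (row (nvar 9) in_d (nvar 7)) (RLoad 1 (row (nvar 10) in_d (nvar 7))))"

lemma run_emit:
  assumes d: "nmem s 0 1 = d"
  shows "run emit_prog s (30 * d + 9) (\<lambda>s'.
    (\<forall>q<d. rmem s' 2 (nmem s 9 0 * d + q) = rmem s 1 (nmem s 10 0 * d + q)) \<and>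
    (\<forall>a<nmem s 9 0 * d. rmem s' 2 a = rmem s 2 a))"
proof -
  let ?c = "RStore 2 (row (nvar 9) in_d (nvar 7)) (RLoad 1 (row (nvar 10) in_d (nvar 7)))"
  let ?I = "\<lambda>j s'. (\<forall>q<j. rmem s' 2 (nmem s 9 0 * d + q) = rmem s 1 (nmem s 10 0 * d + q)) \<and>
    (\<forall>a<nmem s 9 0 * d. rmem s' 2 a = rmem s 2 a)"
  have "run emit_prog s (d * (wcost ?c + ncost in_d + 10) + 7 + ncost in_d) (?I d)"
    unfolding emit_prog_def
  proof (rule run_For[where I = "?I"])
    fix j s' assume "j < d" "?I j s'" "nmem s' 7 0 = j" "frame (For 7 in_d ?c) s s'"
    then show "run ?c s' (wcost ?c) (\<lambda>s''. ?I (Suc j) (set_counter 7 (Suc j) s''))"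
      using d by (intro run_flatI) (auto simp: frame_def less_Suc_eq)
  qed (use d in \<open>auto simp: frame_def\<close>)
  then show ?thesis by (rule run_mono) auto
qed

lemma nwr_choose [simp]: "nwr choose_prog = {10, 6}" "rwr choose_prog = {}" "\<not> flips choose_prog"
  and nwr_update [simp]: "nwr update_prog = {6, 5, 1}" "rwr update_prog = {6, 5}" "\<not> flips update_prog"
  and nwr_emit [simp]: "nwr emit_prog = {7}" "rwr emit_prog = {2}" "\<not> flips emit_prog"
  and nwr_mark [simp]: "nwr mark_prog = {1}" "rwr mark_prog = {5}" "\<not> flips mark_prog"
  by (auto simp: choose_prog_def update_prog_def emit_prog_def mark_prog_def)

definition round_prog :: com where
  "round_prog = Seq choose_prog (Seq update_prog (Seq mark_prog emit_prog))"

lemma nwr_round [simp]: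
  "nwr round_prog = {10, 6, 5, 1, 7}" "rwr round_prog = {6, 5, 2}" "\<not> flips round_prog"
  by (auto simp: round_prog_def)

text \<open>The sequence \<open>cs\<close> is existential because the machine does not store it:
  memory keeps the labels and the coordinates of the chosen points.\<close>

definition traversal_state ::
  "nat \<Rightarrow> nat \<Rightarrow> (nat \<Rightarrow> nat \<Rightarrow> real) \<Rightarrow> (nat \<Rightarrow> nat \<Rightarrow> real) \<Rightarrow> nat \<Rightarrow> state \<Rightarrow> bool" where
  "traversal_state n d \<delta> p j s \<longleftrightarrow> (\<exists>cs. farthest_first n \<delta> j cs (rmem s 5) (nmem s 1) \<and>
    (\<forall>a<j * d. rmem s 2 a = p (cs (a div d)) (a mod d)))"

text \<open>The sketches enter as an arbitrary array \<open>Y\<close>, which keeps the round free of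
  any reference to randomness.\<close>

lemma run_round:
  fixes Y :: "nat \<Rightarrow> nat \<Rightarrow> real" and k :: nat
  defines "\<delta> \<equiv> \<lambda>a b. \<Sum>r<k. (Y a r - Y b r)\<^sup>2"
  assumes n: "nmem s 0 0 = n" and d: "nmem s 0 1 = d" and k: "nmem s 4 0 = k"
    and pts: "\<And>a. a < n * d \<Longrightarrow> rmem s 1 a = p (a div d) (a mod d)"
    and Y: "\<And>i r. i < n \<Longrightarrow> r < k \<Longrightarrow> rmem s 4 (i * k + r) = Y i r"
    and j: "nmem s 9 0 = j" "j < n"
    and inv: "traversal_state n d \<delta> p j s"
  shows "run round_prog s (26 * n + 12 + (n * (56 * k + 57) + 9 + (13 + (30 * d + 9))))
    (traversal_state n d \<delta> p (Suc j))"
proof -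
  obtain cs where ff: "farthest_first n \<delta> j cs (rmem s 5) (nmem s 1)"
    and out: "\<And>a. a < j * d \<Longrightarrow> rmem s 2 a = p (cs (a div d)) (a mod d)"
    using inv unfolding traversal_state_def by blast
  note [simp del] = One_nat_def
  show ?thesis
    unfolding round_prog_def
  proof (rule run_Seq_frame[OF run_choose])
    show "nmem s 0 0 = n" "0 < n" using n j by auto
    fix s1 assume choose: "nmem s1 10 0 < n \<and> (\<forall>i<n. rmem s 5 i \<le> rmem s 5 (nmem s1 10 0))"
      and fr1: "frame choose_prog s s1"
    define c where "c = nmem s1 10 0"
    have c: "c < n" "\<And>i. i < n \<Longrightarrow> rmem s 5 i \<le> rmem s 5 c" using choose by (auto simp: c_def)
    have e1: "nmem s1 0 = nmem s 0" "nmem s1 4 = nmem s 4" "nmem s1 9 = nmem s 9"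
      "nmem s1 1 = nmem s 1" "rmem s1 = rmem s"
      using fr1 by (auto simp: frame_def)
    have \<Delta>: "(\<Sum>r<k. (rmem s1 4 (i * k + r) - rmem s1 4 (nmem s1 10 0 * k + r))\<^sup>2) = \<delta> i c"
      if "i < n" for i
      unfolding \<delta>_def c_def[symmetric] using that c(1) by (intro sum.cong) (simp_all add: e1 Y)
    show "run (Seq update_prog (Seq mark_prog emit_prog)) s1
        (n * (56 * k + 57) + 9 + (13 + (30 * d + 9))) (traversal_state n d \<delta> p (Suc j))"
    proof (rule run_Seq_frame[OF run_update[OF _ _ \<Delta>]])
      show "nmem s1 0 0 = n" "nmem s1 4 0 = k" using e1 n k by auto
      fix s2 assume "\<forall>i<n.
        rmem s2 5 i = (if nmem s1 9 0 = 0 \<or> \<delta> i c < rmem s1 5 i then \<delta> i c else rmem s1 5 i) \<and>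
        nmem s2 1 i = (if nmem s1 9 0 = 0 \<or> \<delta> i c < rmem s1 5 i then nmem s1 9 0 else nmem s1 1 i)"
        and fr2: "frame update_prog s1 s2"
      then have upd: "rmem s2 5 i = (if j = 0 \<or> \<delta> i c < rmem s 5 i then \<delta> i c else rmem s 5 i)"
          "nmem s2 1 i = (if j = 0 \<or> \<delta> i c < rmem s 5 i then j else nmem s 1 i)" if "i < n" for i
        using that by (simp_all add: e1 j)
      have e2: "nmem s2 0 = nmem s 0" "nmem s2 9 = nmem s 9" "nmem s2 10 0 = c"
        "rmem s2 1 = rmem s 1" "rmem s2 2 = rmem s 2"
        using fr2 e1 by (auto simp: frame_def c_def)
      show "run (Seq mark_prog emit_prog) s2 (13 + (30 * d + 9)) (traversal_state n d \<delta> p (Suc j))"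
      proof (rule run_Seq_frame)
        show "run mark_prog s2 13 (\<lambda>s3. rmem s3 5 = (rmem s2 5)(c := -1) \<and>
            nmem s3 1 = (nmem s2 1)(c := j))"
          unfolding mark_prog_def by (rule run_flatI) (auto simp: e2 j)
        fix s3 assume mark: "rmem s3 5 = (rmem s2 5)(c := -1) \<and> nmem s3 1 = (nmem s2 1)(c := j)"
          and fr3: "frame mark_prog s2 s3"
        have e3: "nmem s3 0 = nmem s 0" "nmem s3 9 0 = j" "nmem s3 10 0 = c"
          "rmem s3 1 = rmem s 1" "rmem s3 2 = rmem s 2"
          using fr3 e2 j by (auto simp: frame_def)
        have ff3: "farthest_first n \<delta> (Suc j) (cs(j := c)) (rmem s3 5) (nmem s3 1)"
        proof (rule farthest_first_Suc[OF ff j(2) c])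
          show "0 \<le> \<delta> a b" "\<delta> a b = \<delta> b a" for a b
            by (auto simp: \<delta>_def sum_nonneg power2_commute)
        qed (use mark upd in auto)
        show "run emit_prog s3 (30 * d + 9) (traversal_state n d \<delta> p (Suc j))"
        proof (rule run_frame_mono[OF run_emit])
          show "nmem s3 0 1 = d" using e3 d by simp
          fix s4 assume emit: "(\<forall>q<d. rmem s4 2 (nmem s3 9 0 * d + q) = rmem s3 1 (nmem s3 10 0 * d + q)) \<and>
              (\<forall>a<nmem s3 9 0 * d. rmem s4 2 a = rmem s3 2 a)"
            and fr4: "frame emit_prog s3 s4"
          have "rmem s4 2 a = p ((cs(j := c)) (a div d)) (a mod d)" if a: "a < Suc j * d" for a
          proof (cases "a < j * d")
            case True
            then have "a div d < j" by (simp add: less_mult_imp_div_less)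
            then show ?thesis using True emit out by (simp add: e3)
          next
            case False
            define q where "q = a - j * d"
            have q: "a = j * d + q" "q < d" using False a by (auto simp: q_def)
            have "c * d + q < n * d"
              using c(1) q(2) by (simp add: row_index_less)
            then show ?thesis using emit q pts by (simp add: e3)
          qed
          then show "traversal_state n d \<delta> p (Suc j) s4"
            unfolding traversal_state_def using ff3 fr4
            by (intro exI[of _ "cs(j := c)"]) (simp add: frame_def)
        qed simp
      qed
    qed
  qed
qed

section \<open>The complete program and its output\<close>

definition cluster_prog :: "nat \<Rightarrow> com" where
  "cluster_prog B = Seq log_prog (Seq (dim_prog B) (Seq signs_prog (Seq sketch_prog
    (For 9 in_l round_prog))))"

definition cluster_time :: "nat \<Rightarrow> nat \<Rightarrow> nat \<Rightarrow> nat \<Rightarrow> nat" where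
  "cluster_time n d l k = 18 * n + 9 + (22 * k + 16 + (29 * (k * d) + 12 +
    (n * (k * (36 * d + 36) + 21) + 9 +
    (l * (26 * n + 12 + (n * (56 * k + 57) + 9 + (13 + (30 * d + 9))) + 2 + 10) + 7 + 2))))"

text \<open>Linearity of the projection: a sketched distance is the sketched norm of a difference,
  to which the tail bound applies.\<close>

lemma sketch_sq_diff:
  "sketch_sq k d (\<lambda>i. x i - y i) \<omega> =
    (\<Sum>r<k. (rademacher d x (\<lambda>q. \<omega> (r * d + q)) - rademacher d y (\<lambda>q. \<omega> (r * d + q)))\<^sup>2)"
  by (simp add: sketch_sq_def rademacher_def sum_subtractf right_diff_distrib)

lemma run_cluster:
  fixes \<omega> :: "nat \<Rightarrow> bool" and p :: "nat \<Rightarrow> nat \<Rightarrow> real" and d k :: nat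
  defines "\<delta> \<equiv> \<lambda>a b. sketch_sq k d (\<lambda>i. p a i - p b i) \<omega>"
  assumes inst: "clustering_instance n d l \<epsilon> p" and k: "k = sketch_dim B n \<epsilon>"
  shows "run (cluster_prog B) (input n d l \<epsilon> p \<omega>) (cluster_time n d l k) (traversal_state n d \<delta> p l)"
proof -
  let ?s = "input n d l \<epsilon> p \<omega>"
  note [simp del] = One_nat_def
  have s: "nmem ?s 0 0 = n" "nmem ?s 0 1 = d" "nmem ?s 0 2 = l" "rmem ?s 0 0 = \<epsilon>" "coins ?s = \<omega>"
    "\<And>g a. 0 < g \<Longrightarrow> nmem ?s g a = 0" "\<And>g a. 1 < g \<Longrightarrow> rmem ?s g a = 0"
    "\<And>a. a < n * d \<Longrightarrow> rmem ?s 1 a = p (a div d) (a mod d)"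
    by (auto simp: input_def)
  have \<epsilon>: "0 < \<epsilon>" and l: "l < n" using inst by (auto simp: clustering_instance_def)
  show ?thesis
    unfolding cluster_prog_def cluster_time_def
  proof (rule run_Seq_frame[OF run_log])
    show "nmem ?s 0 0 = n" "nmem ?s 2 0 = 0" using s by auto
    fix s1 assume L: "nmem s1 2 0 = log_ceil n" and "frame log_prog ?s s1"
    then have f1: "\<And>g. g \<notin> {3, 2} \<Longrightarrow> nmem s1 g = nmem ?s g" "rmem s1 = rmem ?s" "coins s1 = coins ?s"
      by (auto simp: frame_def log_prog_def)
    show "run (Seq (dim_prog B) (Seq signs_prog (Seq sketch_prog (For 9 in_l round_prog)))) s1
      (22 * k + 16 + (29 * (k * d) + 12 + (n * (k * (36 * d + 36) + 21) + 9 +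
        (l * (26 * n + 12 + (n * (56 * k + 57) + 9 + (13 + (30 * d + 9))) + 2 + 10) + 7 + 2))))
      (traversal_state n d \<delta> p l)"
      unfolding k
    proof (rule run_Seq_frame[OF run_dim[OF \<epsilon>]], unfold k[symmetric])
      show "rmem s1 0 0 = \<epsilon>" "nmem s1 2 0 = log_ceil n" "nmem s1 4 0 = 0" using s f1 L by auto
      fix s2 assume k2: "nmem s2 4 0 = k" and "frame (dim_prog B) s1 s2"
      then have f2: "\<And>g. g \<notin> {4} \<Longrightarrow> nmem s2 g = nmem s1 g" "rmem s2 = rmem s1" "coins s2 = coins s1"
        by (auto simp: frame_def dim_prog_def)
      show "run (Seq signs_prog (Seq sketch_prog (For 9 in_l round_prog))) s2
        (29 * (k * d) + 12 + (n * (k * (36 * d + 36) + 21) + 9 +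
          (l * (26 * n + 12 + (n * (56 * k + 57) + 9 + (13 + (30 * d + 9))) + 2 + 10) + 7 + 2)))
        (traversal_state n d \<delta> p l)"
      proof (rule run_Seq_frame[OF run_signs])
        show "nmem s2 0 1 = d" "nmem s2 4 0 = k" "coins s2 = \<omega>" using f1 f2 s k2 by auto
        fix s3 assume signs: "\<forall>a<k * d. rmem s3 3 a = sgn_of (\<omega> a)" and "frame signs_prog s2 s3"
        then have f3: "\<And>g. g \<notin> {7, 8} \<Longrightarrow> nmem s3 g = nmem s2 g" "\<And>g. g \<noteq> 3 \<Longrightarrow> rmem s3 g = rmem s2 g"
          by (auto simp: frame_def signs_prog_def)
        show "run (Seq sketch_prog (For 9 in_l round_prog)) s3 (n * (k * (36 * d + 36) + 21) + 9 +
            (l * (26 * n + 12 + (n * (56 * k + 57) + 9 + (13 + (30 * d + 9))) + 2 + 10) + 7 + 2))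
          (traversal_state n d \<delta> p l)"
        proof (rule run_Seq_frame[OF run_sketch])
          show "nmem s3 0 0 = n" "nmem s3 0 1 = d" "nmem s3 4 0 = k"
            "\<And>a. a < n * d \<Longrightarrow> rmem s3 1 a = p (a div d) (a mod d)"
            "\<And>a. a < k * d \<Longrightarrow> rmem s3 3 a = sgn_of (\<omega> a)"
            using f1 f2 f3 s k2 signs by auto
          fix s4 assume sketch: "\<forall>a<n * k. rmem s4 4 a =
              rademacher d (p (a div k)) (\<lambda>q. \<omega> (a mod k * d + q))" and "frame sketch_prog s3 s4"
          then have f4: "\<And>g. g \<notin> {5, 6, 7} \<Longrightarrow> nmem s4 g = nmem s3 g"
            "\<And>g. g \<notin> {4, 6} \<Longrightarrow> rmem s4 g = rmem s3 g"
            by (auto simp: frame_def sketch_prog_def)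
          define Y where "Y i r = rademacher d (p i) (\<lambda>q. \<omega> (r * d + q))" for i r
          have \<delta>: "\<delta> = (\<lambda>a b. \<Sum>r<k. (Y a r - Y b r)\<^sup>2)"
            by (simp add: \<delta>_def sketch_sq_diff Y_def)
          have Y: "rmem s4 4 (i * k + r) = Y i r" if "i < n" "r < k" for i r
          proof -
            have "i * k + r < n * k"
              using that by (simp add: row_index_less)
            then show ?thesis using sketch that by (simp add: Y_def)
          qed
          have e4: "nmem s4 0 0 = n" "nmem s4 0 1 = d" "nmem s4 0 2 = l" "nmem s4 4 0 = k"
              "\<And>a. a < n * d \<Longrightarrow> rmem s4 1 a = p (a div d) (a mod d)"
              "\<And>a. rmem s4 5 a = 0"
            using f1 f2 f3 f4 s k2 by auto
          have "run (For 9 in_l round_prog) s4 (l * (26 * n + 12 + (n * (56 * k + 57) + 9 +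
              (13 + (30 * d + 9))) + ncost in_l + 10) + 7 + ncost in_l) (traversal_state n d \<delta> p l)"
          proof (rule run_For[where I = "traversal_state n d \<delta> p"])
            show "traversal_state n d \<delta> p 0 (set_counter 9 0 s4)"
              unfolding traversal_state_def using e4 by (auto intro: farthest_first_0)
          next
            fix j s5 assume j: "j < l" "nmem s5 9 0 = j" and inv: "traversal_state n d \<delta> p j s5"
              and fr: "frame (For 9 in_l round_prog) s4 s5"
            have "nmem s5 0 = nmem s4 0" "nmem s5 4 = nmem s4 4" "rmem s5 1 = rmem s4 1"
              "rmem s5 4 = rmem s4 4"
              using fr by (auto simp: frame_def)
            then have "run round_prog s5 (26 * n + 12 + (n * (56 * k + 57) + 9 + (13 + (30 * d + 9))))
                (traversal_state n d \<delta> p (Suc j))"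
              unfolding \<delta> using e4 j l Y inv[unfolded \<delta>] by (intro run_round) auto
            then show "run round_prog s5 (26 * n + 12 + (n * (56 * k + 57) + 9 + (13 + (30 * d + 9))))
                (\<lambda>s6. traversal_state n d \<delta> p (Suc j) (set_counter 9 (Suc j) s6))"
              by (rule run_mono) (auto simp: traversal_state_def)
          qed (use e4 in \<open>auto simp: frame_def\<close>)
          then show "run (For 9 in_l round_prog) s4 (l * (26 * n + 12 + (n * (56 * k + 57) + 9 +
              (13 + (30 * d + 9))) + 2 + 10) + 7 + 2) (traversal_state n d \<delta> p l)"
            by (rule run_mono) simp_all
        qed
      qed
    qed
  qed
qed

text \<open>Points vanish from index \<open>d\<close> on, so the \<open>d\<close> stored coordinates
  determine an input point as a whole sequence.\<close>

lemma output_centers_eq: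
  assumes inst: "clustering_instance n d l \<epsilon> p" and cs: "cs ` {..<l} \<subseteq> {..<n}"
    and out: "\<forall>a<l * d. rmem s 2 a = p (cs (a div d)) (a mod d)"
  shows "output_centers d l s = centers l p cs"
proof -
  have "(\<lambda>i. if i < d then rmem s 2 (j * d + i) else 0) = p (cs j)" if "j < l" for j
  proof
    fix i
    have "p (cs j) \<in> topspace (Euclidean_space d)"
      using inst cs that by (auto simp: clustering_instance_def)
    then have "p (cs j) i = 0" if "\<not> i < d"
      using that by (simp add: topspace_Euclidean_space)
    moreover have "j * d + i < l * d" if "i < d"
      using that \<open>j < l\<close> by (simp add: row_index_less)
    ultimately show "(if i < d then rmem s 2 (j * d + i) else 0) = p (cs j) i"
      using out by simp
  qed
  then show ?thesis
    unfolding output_centers_def centers_def image_image by (intro image_cong) auto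
qed

lemma output_clusters_eq: "output_clusters n l p s = clusters n l p (nmem s 1)"
  by (simp add: output_clusters_def clusters_def)

section \<open>Success probability and running time\<close>

text \<open>The success event must be shown measurable before its measure can be compared. The time
  bound \<open>T\<close> makes it depend on the first \<open>T\<close> tosses only; it contains the
  event \<open>G\<close>, which depends on \<open>M\<close> tosses.\<close>

lemma success_prob_ge:
  assumes halts: "\<And>\<omega>. run prog (s\<lparr>coins := \<omega>\<rparr>) T (\<lambda>s'. G \<omega> \<longrightarrow> good s')"
    and good: "\<And>s' u. good (s'\<lparr>coins := u\<rparr>) = good s'"
    and G: "\<And>\<omega> \<omega>'. (\<And>i. i < M \<Longrightarrow> \<omega> i = \<omega>' i) \<Longrightarrow> G \<omega> \<longleftrightarrow> G \<omega>'"
    and bad: "coin_avg M (\<lambda>\<omega>. of_bool (\<not> G \<omega>)) \<le> q"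
  shows "success_prob prog (\<lambda>\<omega>. s\<lparr>coins := \<omega>\<rparr>) good \<ge> 1 - q"
proof -
  define A where "A \<omega> \<longleftrightarrow> (\<exists>t s'. exec prog (s\<lparr>coins := \<omega>\<rparr>) t s' \<and> good s')" for \<omega>
  have prefix: "A \<omega>'" if A: "A \<omega>" and eq: "\<And>i. i < T \<Longrightarrow> \<omega> i = \<omega>' i" for \<omega> \<omega>'
  proof -
    obtain t s' where e: "exec prog (s\<lparr>coins := \<omega>\<rparr>) t s'" and s': "good s'"
      using A unfolding A_def by blast
    obtain t2 s2 where "exec prog (s\<lparr>coins := \<omega>\<rparr>) t2 s2" "t2 \<le> T"
      using halts[of \<omega>] unfolding run_def by blast
    \<comment> \<open>\<open>halts\<close> bounds some run from this state; by determinism it is the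
      run at hand.\<close>
    then have "t \<le> T" using exec_deterministic[OF e] by blast
    then obtain u where "exec prog (s\<lparr>coins := \<omega>'\<rparr>) t (s'\<lparr>coins := u\<rparr>)"
      using exec_prefix[OF e _ eq] by blast
    with s' good show ?thesis unfolding A_def by blast
  qed
  have A_sets: "{\<omega>. A \<omega>} \<in> sets coin_tapes"
    by (rule prefix_event(1)[of T]) (metis prefix)
  have G_sets: "{\<omega>. \<not> G \<omega>} \<in> sets coin_tapes"
    and G_meas: "measure coin_tapes {\<omega>. \<not> G \<omega>} = coin_avg M (\<lambda>\<omega>. of_bool (\<not> G \<omega>))"
    using prefix_event[of M "\<lambda>\<omega>. \<not> G \<omega>"] G by blast+
  have "G \<omega> \<Longrightarrow> A \<omega>" for \<omega>
    using halts[of \<omega>] unfolding A_def run_def by blast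
  then have "space coin_tapes - {\<omega>. \<not> G \<omega>} \<subseteq> {\<omega>. A \<omega>}" by auto
  then have "measure coin_tapes (space coin_tapes - {\<omega>. \<not> G \<omega>}) \<le> measure coin_tapes {\<omega>. A \<omega>}"
    using A_sets by (intro coins.P.finite_measure_mono[folded coin_tapes_def])
  moreover have "measure coin_tapes (space coin_tapes - {\<omega>. \<not> G \<omega>}) = 1 - measure coin_tapes {\<omega>. \<not> G \<omega>}"
    by (rule coins.P.prob_compl[folded coin_tapes_def, OF G_sets])
  ultimately have "1 - q \<le> measure coin_tapes {\<omega>. A \<omega>}" using G_meas bad by linarith
  then show ?thesis by (simp add: success_prob_def A_def)
qed

definition preserves_distances ::
  "nat \<Rightarrow> nat \<Rightarrow> nat \<Rightarrow> real \<Rightarrow> (nat \<Rightarrow> nat \<Rightarrow> real) \<Rightarrow> (nat \<Rightarrow> bool) \<Rightarrow> bool" where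
  "preserves_distances n d k \<eta> p \<omega> \<longleftrightarrow> (\<forall>a<n. \<forall>b<n.
    \<bar>sketch_sq k d (\<lambda>i. p a i - p b i) \<omega> - k * (edist d (p a) (p b))\<^sup>2\<bar>
      \<le> \<eta> * k * (edist d (p a) (p b))\<^sup>2)"

lemma sketch_sq_cong:
  assumes "\<And>i. i < k * d \<Longrightarrow> \<omega> i = \<omega>' i"
  shows "sketch_sq k d x \<omega> = sketch_sq k d x \<omega>'"
proof -
  have "r * d + i < k * d" if "r < k" "i < d" for r i
    using that by (simp add: row_index_less)
  then show ?thesis
    using assms by (simp add: sketch_sq_def rademacher_def)
qed

text \<open>Union bound over the \<open>n^2\<close> ordered pairs, carried out on indicator
  functions before averaging.\<close>

lemma coin_avg_not_preserves_distances:
  assumes "0 \<le> \<eta>" "\<eta> \<le> 1"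
  shows "coin_avg (k * d) (\<lambda>\<omega>. of_bool (\<not> preserves_distances n d k \<eta> p \<omega>)) \<le>
    2 * (real n)\<^sup>2 * exp (- (k * \<eta>\<^sup>2 / 512))"
proof -
  define bad where "bad a b \<omega> \<longleftrightarrow> \<eta> * k * (edist d (p a) (p b))\<^sup>2 <
    \<bar>sketch_sq k d (\<lambda>i. p a i - p b i) \<omega> - k * (edist d (p a) (p b))\<^sup>2\<bar>" for a b \<omega>
  have "of_bool (\<not> preserves_distances n d k \<eta> p \<omega>) \<le> (\<Sum>a<n. \<Sum>b<n. of_bool (bad a b \<omega>) :: real)"
    for \<omega>
  proof (cases "preserves_distances n d k \<eta> p \<omega>")
    case False
    then obtain a b where ab: "a < n" "b < n" "bad a b \<omega>"
      by (auto simp: preserves_distances_def bad_def not_le)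
    have "(1::real) = of_bool (bad a b \<omega>)" using ab by simp
    also have "\<dots> \<le> (\<Sum>b<n. of_bool (bad a b \<omega>))"
      using ab(2) by (intro member_le_sum) auto
    also have "\<dots> \<le> (\<Sum>a<n. \<Sum>b<n. of_bool (bad a b \<omega>))"
      using ab(1) by (intro member_le_sum[where f = "\<lambda>a. \<Sum>b<n. of_bool (bad a b \<omega>)"] sum_nonneg) auto
    finally show ?thesis using False by simp
  qed (simp add: sum_nonneg)
  then have "coin_avg (k * d) (\<lambda>\<omega>. of_bool (\<not> preserves_distances n d k \<eta> p \<omega>)) \<le>
      (\<Sum>a<n. \<Sum>b<n. coin_avg (k * d) (\<lambda>\<omega>. of_bool (bad a b \<omega>)))"
    unfolding coin_avg_sum[symmetric] by (rule coin_avg_mono)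
  also have "\<dots> \<le> (\<Sum>a<n. \<Sum>b<n. 2 * exp (- (k * \<eta>\<^sup>2 / 512)))"
    unfolding bad_def edist_square by (intro sum_mono sketch_sq_tail assms)
  finally show ?thesis by (simp add: power2_eq_square mult_ac)
qed

section \<open>Constants in the failure probability and the running time\<close>

lemma ln_le_log_ceil:
  assumes "0 < n"
  shows "ln (real n) \<le> real (log_ceil n)"
proof -
  have "ln (real n) \<le> ln (2 ^ log_ceil n)"
    using log_ceil_ge[of n] assms by (simp add: of_nat_le_iff[symmetric] del: of_nat_le_iff)
  also have "\<dots> = real (log_ceil n) * ln 2" by (simp add: ln_realpow)
  also have "\<dots> \<le> real (log_ceil n) * 1" using ln_2_less_1 by (intro mult_left_mono) auto
  finally show ?thesis by simp
qed

text \<open>From \<open>ln 2 \<ge> 1/2\<close>, both \<open>log_ceil n - 1\<close> and 1 are at most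
  \<open>2 * ln n\<close>.\<close>

lemma log_ceil_le_ln:
  assumes "2 \<le> n"
  shows "real (log_ceil n) \<le> 4 * ln (real n)" and "1 \<le> log_ceil n"
proof -
  have "log_ceil n \<noteq> 0" using log_ceil_ge[of n] assms by (metis not_less_eq_eq numeral_2_eq_2 power_0 order_trans One_nat_def)
  then show "1 \<le> log_ceil n" by simp
  have half: "1 / 2 \<le> ln (2::real)" using ln2_ge_two_thirds by simp
  have "2 ^ (log_ceil n - 1) < n" using log_ceil_minimal[of n] \<open>log_ceil n \<noteq> 0\<close> by simp
  then have "real (2 ^ (log_ceil n - 1)) < real n" by (simp only: of_nat_less_iff)
  then have "ln (real (2 ^ (log_ceil n - 1))) \<le> ln (real n)" using assms by simp
  then have "real (log_ceil n - 1) * ln 2 \<le> ln (real n)" by (simp add: ln_realpow)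
  moreover have "real (log_ceil n - 1) * (1 / 2) \<le> real (log_ceil n - 1) * ln 2"
    using half by (intro mult_left_mono) auto
  moreover have "ln 2 \<le> ln (real n)" using assms by simp
  ultimately show "real (log_ceil n) \<le> 4 * ln (real n)"
    using half \<open>1 \<le> log_ceil n\<close> by (simp add: of_nat_diff)
qed

text \<open>Minimality bounds the dimension up to one extra step, which costs
  \<open>\<epsilon>^2 \<le> 1\<close> and is absorbed by doubling since
  \<open>B * log_ceil n \<ge> 1\<close>. Positivity is needed because \<open>k\<close> becomes the
  scale \<open>K\<close> of the distortion.\<close>

lemma sketch_dim_le:
  assumes "2 \<le> n" and B: "1 \<le> B" and \<epsilon>: "0 < \<epsilon>" "\<epsilon> < 1"
  shows "1 \<le> sketch_dim B n \<epsilon>" and "real (sketch_dim B n \<epsilon>) \<le> 8 * real B * ln (real n) / \<epsilon>\<^sup>2"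
proof -
  define k where "k = sketch_dim B n \<epsilon>"
  have "1 * 1 \<le> B * log_ceil n" using B log_ceil_le_ln(2)[OF assms(1)] by (rule mult_le_mono)
  then have BL: "1 \<le> real (B * log_ceil n)" by linarith
  show "1 \<le> sketch_dim B n \<epsilon>"
    using sketch_dim_ge[OF \<epsilon>(1), of B n] BL by (cases "sketch_dim B n \<epsilon>") auto
  then have "real (k - 1) * \<epsilon>\<^sup>2 < real (B * log_ceil n)"
    unfolding k_def by (intro sketch_dim_minimal[OF \<epsilon>(1)]) auto
  then have "real k * \<epsilon>\<^sup>2 \<le> real (B * log_ceil n) + \<epsilon>\<^sup>2"
    using \<open>1 \<le> sketch_dim B n \<epsilon>\<close> by (simp add: k_def of_nat_diff algebra_simps)
  also have "\<epsilon>\<^sup>2 \<le> 1" using \<epsilon> by (simp add: power_le_one)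
  also have "real (B * log_ceil n) + 1 \<le> 2 * (real B * real (log_ceil n))" using BL by simp
  also have "\<dots> \<le> 2 * (real B * (4 * ln (real n)))"
    using log_ceil_le_ln(1)[OF assms(1)] by (intro mult_left_mono) auto
  finally have "real k * \<epsilon>\<^sup>2 \<le> 8 * real B * ln (real n)" by simp
  then show "real (sketch_dim B n \<epsilon>) \<le> 8 * real B * ln (real n) / \<epsilon>\<^sup>2"
    using \<epsilon> by (simp add: k_def field_simps)
qed

text \<open>Here \<open>8192 = 16 * 512\<close>, the 16 coming from
  \<open>(\<epsilon> / 4)^2\<close>. The summand 3 next to \<open>\<beta>\<close> supplies a factor
  \<open>n^3\<close> that pays for \<open>2 * n^2\<close>, as \<open>n \<ge> 2\<close>.\<close>

lemma sketch_failure_le: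
  assumes "2 \<le> n" and \<epsilon>: "0 < \<epsilon>" and B: "8192 * (\<beta> + 3) \<le> real B"
  shows "2 * (real n)\<^sup>2 * exp (- (sketch_dim B n \<epsilon> * (\<epsilon> / 4)\<^sup>2 / 512)) \<le> 1 / real n powr \<beta>"
proof -
  have n: "0 < real n" "0 < ln (real n)" using assms(1) by auto
  have "8192 * (\<beta> + 3) * ln (real n) \<le> real B * ln (real n)" using B n by (intro mult_right_mono) auto
  also have "\<dots> \<le> real B * real (log_ceil n)"
    using assms(1) by (intro mult_left_mono ln_le_log_ceil) auto
  also have "\<dots> \<le> real (sketch_dim B n \<epsilon>) * \<epsilon>\<^sup>2" using sketch_dim_ge[OF \<epsilon>, of B n] by simp
  finally have "(\<beta> + 3) * ln (real n) \<le> sketch_dim B n \<epsilon> * (\<epsilon> / 4)\<^sup>2 / 512"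
    by (simp add: power_divide algebra_simps)
  then have "exp (- (sketch_dim B n \<epsilon> * (\<epsilon> / 4)\<^sup>2 / 512)) \<le> exp (- ((\<beta> + 3) * ln (real n)))"
    by simp
  also have "\<dots> = 1 / (real n powr \<beta> * real n ^ 3)"
  proof -
    have "exp (3 * ln (real n)) = real n ^ 3"
      using exp_of_nat_mult[of 3 "ln (real n)"] n by simp
    then have "exp ((\<beta> + 3) * ln (real n)) = real n powr \<beta> * real n ^ 3"
      using n by (simp add: powr_def distrib_right exp_add)
    then show ?thesis by (simp add: exp_minus inverse_eq_divide)
  qed
  finally have "2 * (real n)\<^sup>2 * exp (- (sketch_dim B n \<epsilon> * (\<epsilon> / 4)\<^sup>2 / 512)) \<le>
      real n * (real n)\<^sup>2 * (1 / (real n powr \<beta> * real n ^ 3))"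
    using assms(1) by (intro mult_mono) auto
  also have "\<dots> = 1 / real n powr \<beta>"
    using n by (simp add: power2_eq_square power3_eq_cube)
  finally show ?thesis .
qed

text \<open>Every summand is dominated by \<open>n * k * d\<close> (sketching) or
  \<open>n * k * l\<close> (traversal); the coefficients add up to 441.\<close>

lemma cluster_time_le:
  assumes "0 < n" "0 < k" "0 < l" "l < n"
  shows "cluster_time n d l k \<le> 500 * (n * k * (d + l))"
proof -
  define X where "X = n * k * (d + l)"
  have "n * k * d \<le> X" "n * k * l \<le> X" by (simp_all add: X_def algebra_simps)
  moreover have "1 \<le> n * k * l" "n \<le> n * k * l" "k \<le> n * k * l" "n * k \<le> n * k * l" "l \<le> n * k * l"
    "l * n \<le> n * k * l"
    using assms by simp_all
  moreover have "k * d \<le> n * k * d" "l * d \<le> n * k * d"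
    using assms by (auto intro: mult_le_mono order_trans[of l n "n * k"])
  moreover have "cluster_time n d l k = 36 * (n * k * d) + 56 * (n * k * l) + 36 * (n * k) +
      83 * (l * n) + 29 * (k * d) + 30 * (l * d) + 39 * n + 22 * k + 55 * l + 55"
    by (simp add: cluster_time_def algebra_simps)
  ultimately show ?thesis unfolding X_def[symmetric] by linarith
qed

theorem theorem1:
  fixes \<beta> :: real
  assumes "\<beta> \<ge> 1"
  shows
    "(\<exists>prog C. \<forall>n d l \<epsilon> p. clustering_instance n d l \<epsilon> p \<longrightarrow>
        (\<forall>\<omega>. runs_in_time prog (input n d l \<epsilon> p \<omega>)
          (C * (real n * ln (real n) * real (d + l) / \<epsilon>\<^sup>2))
          (\<lambda>s. output_centers d l s \<subseteq> p ` {..<n} \<and> card (output_centers d l s) = l)) \<and>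
        success_prob prog (input n d l \<epsilon> p)
          (\<lambda>s. center_cost d (p ` {..<n}) (output_centers d l s)
             \<le> (2 + \<epsilon>) * opt_center d (p ` {..<n}) l)
          \<ge> 1 - 1 / real n powr \<beta>) \<and>
     (\<exists>prog C. \<forall>n d l \<epsilon> p. clustering_instance n d l \<epsilon> p \<longrightarrow>
        (\<forall>\<omega>. runs_in_time prog (input n d l \<epsilon> p \<omega>)
          (C * (real n * ln (real n) * real (d + l) / \<epsilon>\<^sup>2))
          (\<lambda>s. partition_on (p ` {..<n}) (output_clusters n l p s) \<and>
               card (output_clusters n l p s) = l)) \<and>
        success_prob prog (input n d l \<epsilon> p)
          (\<lambda>s. diam_cost d (output_clusters n l p s)
             \<le> (2 + \<epsilon>) * opt_diam d (p ` {..<n}) l)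
          \<ge> 1 - 1 / real n powr \<beta>)"
proof -
  \<comment> \<open>\<open>B\<close> depends on \<open>\<beta>\<close> alone, so the program is
    fixed before the instance.\<close>
  define B where "B = nat \<lceil>8192 * (\<beta> + 3)\<rceil>"
  \<comment> \<open>The factor 500 of \<open>cluster_time_le\<close> times the 8 of
    \<open>sketch_dim_le\<close>.\<close>
  define C where "C = 4000 * real B"
  have B: "8192 * (\<beta> + 3) \<le> real B" unfolding B_def by (rule real_nat_ceiling_ge)
  have "1 \<le> 8192 * (\<beta> + 3)" using assms by simp
  also note B
  finally have B1: "1 \<le> B" by simp
  define centers_ok where "centers_ok n d l p s \<longleftrightarrow>
    output_centers d l s \<subseteq> p ` {..<n} \<and> card (output_centers d l s) = l" for n :: nat and d l p s
  define clusters_ok where "clusters_ok n l p s \<longleftrightarrow>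
    partition_on (p ` {..<n}) (output_clusters n l p s) \<and> card (output_clusters n l p s) = l"
    for n :: nat and l p s
  define centers_good where "centers_good n d l \<epsilon> p s \<longleftrightarrow>
    center_cost d (p ` {..<n}) (output_centers d l s) \<le> (2 + \<epsilon>) * opt_center d (p ` {..<n}) l"
    for n :: nat and d l \<epsilon> p s
  define clusters_good where "clusters_good n d l \<epsilon> p s \<longleftrightarrow>
    diam_cost d (output_clusters n l p s) \<le> (2 + \<epsilon>) * opt_diam d (p ` {..<n}) l"
    for n :: nat and d l \<epsilon> p s
  \<comment> \<open>One program serves both claims; \<open>which\<close> selects the output form
    together with the matching guarantee.\<close>
  have main: "(\<forall>\<omega>. runs_in_time (cluster_prog B) (input n d l \<epsilon> p \<omega>)
        (C * (real n * ln (real n) * real (d + l) / \<epsilon>\<^sup>2)) ok) \<and>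
      success_prob (cluster_prog B) (input n d l \<epsilon> p) good \<ge> 1 - 1 / real n powr \<beta>"
    if inst: "clustering_instance n d l \<epsilon> p"
      and which: "ok = centers_ok n d l p \<and> good = centers_good n d l \<epsilon> p \<or>
        ok = clusters_ok n l p \<and> good = clusters_good n d l \<epsilon> p"
    for n d l \<epsilon> p ok good
  proof -
    have l: "0 < l" "l < n" and \<epsilon>: "0 < \<epsilon>" "\<epsilon> < 1/2"
      using inst by (auto simp: clustering_instance_def)
    then have n: "2 \<le> n" by simp
    define k where "k = sketch_dim B n \<epsilon>"
    have k: "1 \<le> k" "real k \<le> 8 * real B * ln (real n) / \<epsilon>\<^sup>2"
      unfolding k_def using sketch_dim_le[OF n B1 \<epsilon>(1)] \<epsilon>(2) by auto
    define T where "T = cluster_time n d l k"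
    let ?G = "preserves_distances n d k (\<epsilon> / 4) p"
    have run: "run (cluster_prog B) (input n d l \<epsilon> p \<omega>) T (\<lambda>s. ok s \<and> (?G \<omega> \<longrightarrow> good s))" for \<omega>
      unfolding T_def
    proof (rule run_mono[OF run_cluster[OF inst k_def] order_refl])
      fix s
      let ?\<delta> = "\<lambda>a b. sketch_sq k d (\<lambda>i. p a i - p b i) \<omega>"
      assume "traversal_state n d ?\<delta> p l s"
      then obtain cs where ff: "farthest_first n ?\<delta> l cs (rmem s 5) (nmem s 1)"
        and out: "\<forall>a<l * d. rmem s 2 a = p (cs (a div d)) (a mod d)"
        unfolding traversal_state_def by blast
      have "output_centers d l s = centers l p cs"
        using ff by (intro output_centers_eq[OF inst _ out]) (simp add: farthest_first_def)
      moreover have "centers_good n d l \<epsilon> p s \<and> clusters_good n d l \<epsilon> p s" if "?G \<omega>"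
        using farthest_first_approx[OF inst ff, of "real k"] that k(1) calculation
        by (simp add: sketch_sq_diff power2_commute preserves_distances_def
            centers_good_def clusters_good_def output_clusters_eq)
      ultimately show "ok s \<and> (?G \<omega> \<longrightarrow> good s)"
        using which centers_valid[OF inst ff] clusters_valid[OF inst ff]
        by (auto simp: centers_ok_def clusters_ok_def output_clusters_eq)
    qed
    have "real T \<le> real (500 * (n * k * (d + l)))"
      unfolding T_def using l k(1) by (intro of_nat_mono cluster_time_le) auto
    also have "\<dots> = 500 * (real n * real (d + l)) * real k" by simp
    also have "\<dots> \<le> 500 * (real n * real (d + l)) * (8 * real B * ln (real n) / \<epsilon>\<^sup>2)"
      using k(2) by (intro mult_left_mono) auto
    also have "\<dots> = C * (real n * ln (real n) * real (d + l) / \<epsilon>\<^sup>2)"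
      by (simp add: C_def)
    finally have T: "real T \<le> C * (real n * ln (real n) * real (d + l) / \<epsilon>\<^sup>2)" .
    have "runs_in_time (cluster_prog B) (input n d l \<epsilon> p \<omega>)
        (C * (real n * ln (real n) * real (d + l) / \<epsilon>\<^sup>2)) ok" for \<omega>
    proof -
      obtain t s' where "exec (cluster_prog B) (input n d l \<epsilon> p \<omega>) t s'" "t \<le> T" "ok s'"
        using run[of \<omega>] unfolding run_def by blast
      moreover from this(2) have "real t \<le> C * (real n * ln (real n) * real (d + l) / \<epsilon>\<^sup>2)"
        using T by linarith
      ultimately show ?thesis unfolding runs_in_time_def by blast
    qed
    moreover have "success_prob (cluster_prog B) (input n d l \<epsilon> p) good \<ge> 1 - 1 / real n powr \<beta>"
    proof -
      \<comment> \<open>Only the tape varies with the outcome, which is the form that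
        \<open>success_prob_ge\<close> expects.\<close>
      have inp: "input n d l \<epsilon> p \<omega> = (input n d l \<epsilon> p (\<lambda>_. False))\<lparr>coins := \<omega>\<rparr>" for \<omega>
        by (simp add: input_def)
      have "success_prob (cluster_prog B) (\<lambda>\<omega>. (input n d l \<epsilon> p (\<lambda>_. False))\<lparr>coins := \<omega>\<rparr>) good
          \<ge> 1 - 1 / real n powr \<beta>"
      proof (rule success_prob_ge[where G = ?G and M = "k * d" and T = T])
        fix \<omega>
        show "run (cluster_prog B) ((input n d l \<epsilon> p (\<lambda>_. False))\<lparr>coins := \<omega>\<rparr>) T
            (\<lambda>s'. ?G \<omega> \<longrightarrow> good s')"
          unfolding inp[symmetric] by (rule run_mono[OF run order_refl]) blast
      next
        show "good (s'\<lparr>coins := u\<rparr>) = good s'" for s' u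
        proof -
          have "output_centers d l (s'\<lparr>coins := u\<rparr>) = output_centers d l s'"
            unfolding output_centers_def by (intro image_cong ext) simp_all
          moreover have "output_clusters n l p (s'\<lparr>coins := u\<rparr>) = output_clusters n l p s'"
            unfolding output_clusters_def by simp
          ultimately show ?thesis
            using which by (auto simp: centers_good_def clusters_good_def)
        qed
      next
        show "?G \<omega> \<longleftrightarrow> ?G \<omega>'" if "\<And>i. i < k * d \<Longrightarrow> \<omega> i = \<omega>' i" for \<omega> \<omega>'
          unfolding preserves_distances_def using sketch_sq_cong[of k d \<omega> \<omega>', OF that] by simp
      next
        have "coin_avg (k * d) (\<lambda>\<omega>. of_bool (\<not> ?G \<omega>)) \<le>
            2 * (real n)\<^sup>2 * exp (- (k * (\<epsilon> / 4)\<^sup>2 / 512))"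
          using \<epsilon> by (intro coin_avg_not_preserves_distances) auto
        also have "\<dots> \<le> 1 / real n powr \<beta>"
          unfolding k_def by (rule sketch_failure_le[OF n \<epsilon>(1) B])
        finally show "coin_avg (k * d) (\<lambda>\<omega>. of_bool (\<not> ?G \<omega>)) \<le> 1 / real n powr \<beta>" .
      qed
      then show ?thesis unfolding inp[symmetric] .
    qed
    ultimately show ?thesis by blast
  qed
  show ?thesis
  proof (rule conjI)
    show "\<exists>prog C. \<forall>n d l \<epsilon> p. clustering_instance n d l \<epsilon> p \<longrightarrow>
        (\<forall>\<omega>. runs_in_time prog (input n d l \<epsilon> p \<omega>)
          (C * (real n * ln (real n) * real (d + l) / \<epsilon>\<^sup>2))
          (\<lambda>s. output_centers d l s \<subseteq> p ` {..<n} \<and> card (output_centers d l s) = l)) \<and>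
        success_prob prog (input n d l \<epsilon> p)
          (\<lambda>s. center_cost d (p ` {..<n}) (output_centers d l s)
             \<le> (2 + \<epsilon>) * opt_center d (p ` {..<n}) l)
          \<ge> 1 - 1 / real n powr \<beta>"
      by (intro exI[of _ "cluster_prog B"] exI[of _ C] allI impI main)
        (simp_all add: centers_ok_def centers_good_def fun_eq_iff)
    show "\<exists>prog C. \<forall>n d l \<epsilon> p. clustering_instance n d l \<epsilon> p \<longrightarrow>
        (\<forall>\<omega>. runs_in_time prog (input n d l \<epsilon> p \<omega>)
          (C * (real n * ln (real n) * real (d + l) / \<epsilon>\<^sup>2))
          (\<lambda>s. partition_on (p ` {..<n}) (output_clusters n l p s) \<and>
               card (output_clusters n l p s) = l)) \<and>
        success_prob prog (input n d l \<epsilon> p)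
          (\<lambda>s. diam_cost d (output_clusters n l p s)
             \<le> (2 + \<epsilon>) * opt_diam d (p ` {..<n}) l)
          \<ge> 1 - 1 / real n powr \<beta>"
      by (intro exI[of _ "cluster_prog B"] exI[of _ C] allI impI main)
        (simp_all add: clusters_ok_def clusters_good_def fun_eq_iff)
  qed
qed

end
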